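(* For $m\ge1$ let $F_m(t)=\sum_{r\ge0}b(m^r)t^r$ and $F^*_m(t)=\sum_{r\ge0}b^*(m^r)t^r$, where $b(m^r)$ (resp. $b^*(m^r)$) is the number of alternating (resp. reverse alternating) permutations in $\mathfrak S_{mr}$ of cycle type $\langle m^r\rangle$ (all cycles of length $m$). Then, umbrally: (a) If $m=2^kh$ with $k\ge1$, $h\ge3$, $h$ odd, then $F_m(t)=F^*_m(t)=\left(\frac{1+t}{1-t}\right)^{\frac1{2m}\sum_{d\mid h}\mu(d)E^{m/d}}$. (b) If $m=2^k$ with $k\ge2$, then $F_m(t)=F^*_m(t)=\left(\frac{1+t}{1-t}\right)^{\frac1{2m}(E^m-1)}$. (c) $F_2(t)=\left(\frac{1+t}{1-t}\right)^{(E^2+1)/4}$ and $F_2^*(t)=\frac{F_2(t)}{1+t}$.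
   Context: A permutation $a_1\cdots a_n$ is alternating if $a_1>a_2<a_3>\cdots$ and reverse alternating if $a_1<a_2>a_3<\cdots$. $\mu$ is the Möbius function. Euler numbers $E_n$: $\sum_{n\ge0}E_nx^n/n!=\sec x+\tan x$. An expression $\left(\frac{1+t}{1-t}\right)^{g(E)}$ means $\exp\!\left(g(E)\log\frac{1+t}{1-t}\right)$, expanded as a formal power series in $t$ with coefficients polynomials in an indeterminate $E$; umbral evaluation then expands each coefficient in powers of $E$ and, as the last step, replaces each $E^k$ by $E_k$. *)

theory Defs
  imports
    Complex_Main
    "HOL-Library.Multiset"
    "HOL-Combinatorics.Combinatorics"
    "HOL-Combinatorics.Orbits"
    "HOL-Computational_Algebra.Computational_Algebra"
begin

text \<open>A permutation of \<open>{1..n}\<close> is a function \<open>p\<close> with \<open>p permutes {1..n}\<close>, identified with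
  the word \<open>p 1, p 2, \<dots>, p n\<close>.\<close>

definition alternating :: "nat \<Rightarrow> (nat \<Rightarrow> nat) \<Rightarrow> bool" where
  "alternating n a \<longleftrightarrow>
     (\<forall>i. 1 \<le> i \<and> i < n \<longrightarrow> (if odd i then a i > a (i + 1) else a i < a (i + 1)))"

definition reverse_alternating :: "nat \<Rightarrow> (nat \<Rightarrow> nat) \<Rightarrow> bool" where
  "reverse_alternating n a \<longleftrightarrow>
     (\<forall>i. 1 \<le> i \<and> i < n \<longrightarrow> (if odd i then a i < a (i + 1) else a i > a (i + 1)))"

definition cycle_type :: "(nat \<Rightarrow> nat) \<Rightarrow> nat set \<Rightarrow> nat multiset" where
  "cycle_type p S = image_mset card (mset_set (orbit p ` S))"

definition b_alt :: "nat \<Rightarrow> nat \<Rightarrow> nat" where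
  "b_alt m r = card {p. p permutes {1..m * r} \<and> alternating (m * r) p \<and>
                        cycle_type p {1..m * r} = replicate_mset r m}"

definition b_rev :: "nat \<Rightarrow> nat \<Rightarrow> nat" where
  "b_rev m r = card {p. p permutes {1..m * r} \<and> reverse_alternating (m * r) p \<and>
                        cycle_type p {1..m * r} = replicate_mset r m}"

definition F_alt :: "nat \<Rightarrow> real fps" where
  "F_alt m = Abs_fps (\<lambda>r. real (b_alt m r))"

definition F_rev :: "nat \<Rightarrow> real fps" where
  "F_rev m = Abs_fps (\<lambda>r. real (b_rev m r))"

definition moebius :: "nat \<Rightarrow> int" where
  "moebius n = (if squarefree n then (- 1) ^ card (prime_factors n) else 0)"

text \<open>\<open>\<Sum>\<^sub>n E\<^sub>n x\<^sup>n / n! = sec x + tan x\<close>\<close>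

definition euler_number :: "nat \<Rightarrow> real" where
  "euler_number n = fact n * fps_nth (inverse (fps_cos 1) + fps_tan 1) n"

text \<open>\<open>exp (g log f)\<close> for a series \<open>f\<close> with constant term 1 and a polynomial \<open>g\<close> in the
  indeterminate \<open>E\<close>, as a power series in \<open>t\<close> with coefficients in \<open>\<real>[E]\<close>. The library series
  \<open>fps_ln 1\<close> is \<open>log (1 + t)\<close>; \<open>fps_lift\<close> embeds \<open>\<real>[[t]]\<close> into \<open>\<real>[E][[t]]\<close>.\<close>

definition fps_lift :: "real fps \<Rightarrow> real poly fps" where
  "fps_lift f = Abs_fps (\<lambda>n. [:fps_nth f n:])"

definition fps_log :: "real fps \<Rightarrow> real fps" where
  "fps_log f = fps_ln 1 oo (f - 1)"

definition fps_pow_poly :: "real fps \<Rightarrow> real poly \<Rightarrow> real poly fps" where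
  "fps_pow_poly f g = fps_lift (fps_exp 1) oo (fps_const g * fps_lift (fps_log f))"

definition umbral_eval :: "real poly \<Rightarrow> real" where
  "umbral_eval p = (\<Sum>k\<le>degree p. coeff p k * euler_number k)"

definition umbral :: "real poly fps \<Rightarrow> real fps" where
  "umbral f = Abs_fps (\<lambda>n. umbral_eval (fps_nth f n))"

text \<open>The umbral evaluation of \<open>((1 + t) / (1 - t))\<^bsup>g(E)\<^esup>\<close>\<close>

definition umbral_ratio_pow :: "real poly \<Rightarrow> real fps" where
  "umbral_ratio_pow g = umbral (fps_pow_poly ((1 + fps_X) / (1 - fps_X)) g)"

end

theory Submission
  imports Defs "HOL-Library.List_Lexorder" "HOL-Analysis.Weierstrass_Theorems"
begin

unbundle no vec_syntax

text \<open>
  Gessel and Reutenauer: pairs of a permutation \<open>p\<close> of \<open>{1..mr}\<close> with all cycles of length \<open>m\<close>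
  and a word \<open>f\<close> such that the pairs \<open>(f i, p i)\<close> increase lexicographically correspond to
  multisets of \<open>r\<close> primitive necklaces of length \<open>m\<close>, with the same multiset of letters. Weight
  the letter \<open>a\<close> by a sign \<open>x\<^sub>a\<close>. For \<open>l\<close> letters the total weight is then a polynomial in \<open>l\<close>
  and the square of the letter sum \<open>s\<close>, because the power sums of the \<open>x\<^sub>a\<close> are \<open>l\<close> and \<open>s\<close>.
  Averaging over the signs leaves the words in which every letter has even multiplicity, and
  their number for fixed \<open>p\<close> is a binomial coefficient \<open>C(l + a, mr/2)\<close>, where \<open>a\<close> counts the
  ascents of \<open>p\<close> at even positions. As a polynomial in \<open>l\<close> it vanishes at \<open>l = -1\<close>
  unless \<open>a = 0\<close>, that is, unless \<open>p\<close> is reverse alternating. The average of \<open>s\<^sup>n\<close> is \<open>n!\<close> times a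
  coefficient of \<open>cosh\<^sup>l\<close>, so that \<open>l = -1\<close> produces the secant numbers. Alternating
  permutations are treated in the same way by averaging against \<open>x\<^sub>1 x\<^sub>l\<close> and evaluating
  at \<open>l = 1\<close>.
\<close>

section \<open>Moebius inversion\<close>

lemma moebius_Suc_0 [simp]: "moebius (Suc 0) = 1"
  by (simp add: moebius_def)

lemma moebius_prime_mult:
  assumes "prime q" "\<not> q dvd d" "d > 0"
  shows "moebius (q * d) = - moebius d"
proof -
  have "coprime q d" using assms(1,2) by (simp add: prime_imp_coprime)
  then have "squarefree (q * d) \<longleftrightarrow> squarefree d"
    using assms(1) by (auto simp: squarefree_mult_coprime squarefree_prime intro: squarefree_multD)
  moreover have "prime_factors (q * d) = insert q (prime_factors d)"
    using assms by (subst prime_factors_product) (auto simp: prime_prime_factors)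
  moreover have "q \<notin> prime_factors d" using assms(2) by auto
  ultimately show ?thesis by (simp add: moebius_def)
qed

lemma moebius_prime_square_dvd:
  assumes "prime q" "q\<^sup>2 dvd d"
  shows "moebius d = 0"
proof -
  have "\<not> is_unit q" using assms(1) by (metis not_prime_unit)
  with assms(2) have "\<not> squarefree d" by (auto simp: squarefree_def)
  then show ?thesis by (simp add: moebius_def)
qed

lemma sum_moebius_prime_split:
  fixes g :: "nat \<Rightarrow> 'b::comm_ring_1"
  assumes "n > 0" "prime q" "q dvd n"
  shows "(\<Sum>d | d dvd n. of_int (moebius d) * g d) =
    (\<Sum>d | d dvd n \<and> \<not> q dvd d. of_int (moebius d) * (g d - g (q * d)))"
proof -
  let ?D = "{d. d dvd n \<and> \<not> q dvd d}"
  have finite: "finite {d. d dvd n}" "finite ?D" using assms(1) by auto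
  have q: "q > 0" using assms(2) by (simp add: prime_gt_0_nat)
  have pos: "d > 0" if "d dvd n" for d using that assms(1) by (auto intro: Nat.gr0I)
  have "(\<Sum>d | d dvd n. of_int (moebius d) * g d) =
      (\<Sum>d\<in>?D \<union> (*) q ` ?D. of_int (moebius d) * g d)"
  proof (rule sum.mono_neutral_right[OF finite(1)], goal_cases)
    case 1
    show ?case using assms(2,3) by (auto intro!: divides_mult simp: prime_imp_coprime)
  next
    case 2
    show ?case
    proof
      fix d assume d: "d \<in> {d. d dvd n} - (?D \<union> (*) q ` ?D)"
      then obtain e where e: "d = q * e" by auto
      then have "e dvd n" using d by (auto intro: dvd_mult_right)
      then have "q\<^sup>2 dvd d" using d e by (auto simp: power2_eq_square)
      then show "of_int (moebius d) * g d = 0" using moebius_prime_square_dvd[OF assms(2)] by simp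
    qed
  qed
  also have "\<dots> = (\<Sum>d\<in>?D. of_int (moebius d) * g d) + (\<Sum>d\<in>(*) q ` ?D. of_int (moebius d) * g d)"
    by (rule sum.union_disjoint) (use finite in auto)
  also have "(\<Sum>d\<in>(*) q ` ?D. of_int (moebius d) * g d) =
      (\<Sum>d\<in>?D. of_int (moebius (q * d)) * g (q * d))"
    by (subst sum.reindex) (use q in \<open>auto simp: inj_on_def\<close>)
  also have "\<dots> = (\<Sum>d\<in>?D. - (of_int (moebius d) * g (q * d)))"
    by (rule sum.cong) (use moebius_prime_mult[OF assms(2)] pos in auto)
  finally show ?thesis by (simp add: sum_negf sum_subtractf algebra_simps)
qed

lemma sum_moebius_divisors:
  assumes "n > 0"
  shows "(\<Sum>d | d dvd n. of_int (moebius d)) = (if n = 1 then 1 else 0 :: 'b::comm_ring_1)"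
proof (cases "n = 1")
  case False
  then obtain q where "prime q" "q dvd n" using prime_factor_nat by blast
  then show ?thesis
    using sum_moebius_prime_split[OF assms, of q "\<lambda>_. 1 :: 'b"] False by simp
qed simp

lemma moebius_inversion:
  fixes f g :: "nat \<Rightarrow> 'b::comm_ring_1"
  assumes "n > 0" and f: "\<And>k. k dvd n \<Longrightarrow> f k = (\<Sum>e | e dvd k. g e)"
  shows "g n = (\<Sum>d | d dvd n. of_int (moebius d) * f (n div d))"
proof -
  have dvd_div_swap: "d dvd n \<and> e dvd n div d \<longleftrightarrow> e dvd n \<and> d dvd n div e" for d e
    using assms(1) by (metis dvd_div_iff_mult dvd_mult_left mult.commute dvd_0_left_iff not_gr0)
  have "(\<Sum>d | d dvd n. of_int (moebius d) * f (n div d)) =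
      (\<Sum>d | d dvd n. \<Sum>e | e dvd n \<and> d dvd n div e. of_int (moebius d) * g e)"
  proof (rule sum.cong[OF refl])
    fix d assume "d \<in> {d. d dvd n}"
    then have d: "d dvd n" by simp
    then have "{e. e dvd n div d} = {e. e dvd n \<and> d dvd n div e}" using dvd_div_swap by blast
    moreover have "n div d dvd n" using d by (auto elim!: dvdE)
    ultimately show "of_int (moebius d) * f (n div d) =
        (\<Sum>e | e dvd n \<and> d dvd n div e. of_int (moebius d) * g e)"
      by (simp add: f sum_distrib_left)
  qed
  also have "\<dots> = (\<Sum>e | e dvd n. \<Sum>d | d dvd n \<and> d dvd n div e. of_int (moebius d) * g e)"
    using assms(1) sum.swap_restrict[of "{d. d dvd n}" "{d. d dvd n}"
        "\<lambda>d e. of_int (moebius d) * g e" "\<lambda>d e. d dvd n div e"] by simp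
  also have "\<dots> = (\<Sum>e | e dvd n. if e = n then g n else 0)"
  proof (rule sum.cong[OF refl])
    fix e assume "e \<in> {e. e dvd n}"
    then have e: "e dvd n" by simp
    then have "{d. d dvd n \<and> d dvd n div e} = {d. d dvd n div e}"
      using dvd_div_swap by blast
    moreover have "n div e = 1 \<longleftrightarrow> e = n" using e assms(1) by (auto elim!: dvdE)
    ultimately show "(\<Sum>d | d dvd n \<and> d dvd n div e. of_int (moebius d) * g e) =
        (if e = n then g n else 0)"
      using sum_moebius_divisors[of "n div e", where 'b = 'b] e assms(1)
      by (auto simp flip: sum_distrib_right elim!: dvdE)
  qed
  also have "\<dots> = g n" using assms(1) by simp
  finally show ?thesis ..
qed

section \<open>Primitive words\<close>

lemma funpow_eq_self_iff_least_power_dvd: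
  assumes "(f ^^ n) x = x" "n > 0"
  shows "(f ^^ k) x = x \<longleftrightarrow> least_power f x dvd k"
proof
  assume "least_power f x dvd k"
  then obtain c where "k = least_power f x * c" by auto
  moreover have "(f ^^ (least_power f x * c)) x = x" for c
    by (induction c) (simp_all add: funpow_add least_powerI(1)[OF assms])
  ultimately show "(f ^^ k) x = x" by simp
qed (rule least_power_minimal)

lemma rotate_eq_self_iff: "rotate s w = w \<longleftrightarrow> least_power rotate1 w dvd s"
proof -
  have "rotate (max 1 (length w)) w = w" by (cases "w = []") (simp_all add: max_def Suc_le_eq)
  then show ?thesis
    unfolding rotate_def by (rule funpow_eq_self_iff_least_power_dvd) simp
qed

definition primitive_words :: "nat \<Rightarrow> 'a set \<Rightarrow> 'a list set" where
  "primitive_words m A = {w. length w = m \<and> set w \<subseteq> A \<and> least_power rotate1 w = m}"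

lemma finite_primitive_words: "finite A \<Longrightarrow> finite (primitive_words m A)"
  by (rule finite_subset[OF _ finite_lists_length_eq[of A m]]) (auto simp: primitive_words_def)

lemma rotate_concat_replicate:
  "rotate s (concat (replicate k u)) = concat (replicate k (rotate s u))"
proof -
  have shift: "concat (replicate k (a # v)) @ [a] = a # concat (replicate k (v @ [a]))" for a v
    by (induction k) simp_all
  have rotate1: "rotate1 (concat (replicate k u)) = concat (replicate k (rotate1 u))" for u
  proof (cases u)
    case (Cons a v)
    then show ?thesis using shift[of a v] by (cases k) simp_all
  qed (induction k, simp_all)
  show ?thesis by (induction s) (simp_all add: rotate1)
qed

lemma concat_replicate_eq_iff:
  assumes "k > 0" "length u = length v"
  shows "concat (replicate k u) = concat (replicate k v) \<longleftrightarrow> u = v"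
  using assms by (cases k) auto

lemma length_concat_replicate: "length (concat (replicate k u)) = k * length u"
  by (induction k) auto

lemma least_power_rotate1_concat_replicate:
  "k > 0 \<Longrightarrow> least_power rotate1 (concat (replicate k u)) = least_power rotate1 u"
  unfolding least_power_def
  by (simp add: rotate_concat_replicate concat_replicate_eq_iff flip: rotate_def)

lemma concat_replicate_take_least_power:
  fixes w :: "'a list"
  defines "e \<equiv> least_power rotate1 w"
  assumes "w \<noteq> []"
  shows "e dvd length w" "concat (replicate (length w div e) (take e w)) = w"
proof -
  show e_dvd: "e dvd length w" unfolding e_def by (simp flip: rotate_eq_self_iff)
  then have "e > 0" using assms(2) by (auto intro: Nat.gr0I)
  have "e \<le> length w" using e_dvd assms(2) by (auto intro: dvd_imp_le)
  then have "drop e w @ take e w = w"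
    using rotate_eq_self_iff[of e w] assms(2)
    by (cases "e = length w") (simp_all add: e_def rotate_drop_take)
  then have "take e w @ drop e w = drop e w @ take e w" by simp
  then obtain j k z where z: "concat (replicate j z) = take e w" "concat (replicate k z) = drop e w"
    using comm_append_are_replicate by blast
  then have w: "w = concat (replicate (j + k) z)"
    by (metis append_take_drop_id concat_append replicate_add)
  have "e = j * length z"
    using z(1) \<open>e \<le> length w\<close> by (metis length_concat_replicate length_take min_absorb2)
  moreover have "e dvd length z"
    unfolding e_def rotate_eq_self_iff[symmetric] by (simp add: w rotate_concat_replicate)
  ultimately have "j = 1"
    using \<open>e > 0\<close> by (auto elim!: dvdE)
  then have "take e w = z" "length z = e" using z(1) \<open>e = j * length z\<close> by auto
  moreover have "length w div e = j + k"
    using w \<open>length z = e\<close> \<open>e > 0\<close>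
    by (metis length_concat_replicate nonzero_mult_div_cancel_right not_gr0)
  ultimately show "concat (replicate (length w div e) (take e w)) = w" using w by simp
qed

lemma bij_betw_primitive_powers:
  assumes "m > 0"
  shows "bij_betw (\<lambda>(e, u). concat (replicate (m div e) u))
    (SIGMA e:{e. e dvd m}. primitive_words e A) {w. set w \<subseteq> A \<and> length w = m}"
    (is "bij_betw ?f ?S ?T")
proof (rule bij_betw_byWitness[
    where f' = "\<lambda>w. (least_power rotate1 w, take (least_power rotate1 w) w)"])
  have pos: "m div e > 0" if "e dvd m" for e
    using that assms by (auto elim!: dvdE)
  have inv: "least_power rotate1 (?f (e, u)) = e" "take e (?f (e, u)) = u"
    if "(e, u) \<in> ?S" for e u
  proof -
    show "least_power rotate1 (?f (e, u)) = e"
      using that pos[of e] by (simp add: least_power_rotate1_concat_replicate primitive_words_def)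
    show "take e (?f (e, u)) = u"
      using that pos[of e] by (cases "m div e") (auto simp: primitive_words_def)
  qed
  then show "\<forall>x\<in>?S. (least_power rotate1 (?f x), take (least_power rotate1 (?f x)) (?f x)) = x"
    by (metis surj_pair)
  show "?f ` ?S \<subseteq> ?T"
    using pos by (auto simp: primitive_words_def length_concat_replicate)
  have root: "least_power rotate1 w dvd m"
    "concat (replicate (m div least_power rotate1 w) (take (least_power rotate1 w) w)) = w"
    if "w \<in> ?T" for w
    using that assms concat_replicate_take_least_power[of w] by auto
  then show "\<forall>w\<in>?T. ?f (least_power rotate1 w, take (least_power rotate1 w) w) = w" by simp
  show "(\<lambda>w. (least_power rotate1 w, take (least_power rotate1 w) w)) ` ?T \<subseteq> ?S"
  proof (rule image_subsetI)
    fix w assume w: "w \<in> ?T"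
    let ?e = "least_power rotate1 w"
    have "least_power rotate1 (take ?e w) = ?e"
      using least_power_rotate1_concat_replicate[OF pos[OF root(1)[OF w]], of "take ?e w"]
        root(2)[OF w] by simp
    moreover have "length (take ?e w) = ?e"
      using w assms dvd_imp_le[OF root(1)[OF w]] by simp
    moreover have "set (take ?e w) \<subseteq> A" using w set_take_subset[of ?e w] by auto
    ultimately show "(?e, take ?e w) \<in> ?S"
      using root(1)[OF w] by (simp add: primitive_words_def)
  qed
qed

lemma sum_prod_list_words:
  fixes x :: "'a \<Rightarrow> 'b::comm_semiring_1"
  assumes "finite A"
  shows "(\<Sum>w | set w \<subseteq> A \<and> length w = m. prod_list (map x w)) = (\<Sum>a\<in>A. x a) ^ m"
proof (induction m)
  case 0
  have "{w. set w \<subseteq> A \<and> length w = 0} = {[]}" by auto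
  then show ?case by simp
next
  case (Suc m)
  let ?T = "{w. set w \<subseteq> A \<and> length w = m}"
  have "(\<Sum>w | set w \<subseteq> A \<and> length w = Suc m. prod_list (map x w)) =
      (\<Sum>(a, w)\<in>A \<times> ?T. prod_list (map x (a # w)))"
    by (rule sum.reindex_bij_witness[of _ "\<lambda>(a, w). a # w" "\<lambda>w. (hd w, tl w)"])
      (auto simp: length_Suc_conv)
  also have "\<dots> = (\<Sum>a\<in>A. x a) * (\<Sum>w\<in>?T. prod_list (map x w))"
    by (simp add: sum_product sum.cartesian_product)
  finally show ?case using Suc by simp
qed

lemma prod_list_map_power:
  fixes x :: "'a \<Rightarrow> 'b::comm_monoid_mult"
  shows "prod_list (map (\<lambda>a. x a ^ j) w) = prod_list (map x w) ^ j"
  by (induction w) (simp_all add: power_mult_distrib)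

lemma prod_list_map_concat_replicate:
  fixes x :: "'a \<Rightarrow> 'b::comm_monoid_mult"
  shows "prod_list (map x (concat (replicate k u))) = prod_list (map x u) ^ k"
  by (induction k) simp_all

lemma sum_primitive_words:
  fixes x :: "'a \<Rightarrow> 'b::comm_ring_1"
  assumes "finite A" "m > 0"
  shows "(\<Sum>w\<in>primitive_words m A. prod_list (map x w) ^ j) =
    (\<Sum>d | d dvd m. of_int (moebius d) * (\<Sum>a\<in>A. x a ^ (j * d)) ^ (m div d))"
proof -
  let ?f = "\<lambda>k. (\<Sum>a\<in>A. x a ^ (j * (m div k))) ^ k"
  let ?g = "\<lambda>e. \<Sum>u\<in>primitive_words e A. prod_list (map x u) ^ (j * (m div e))"
  have "?f k = (\<Sum>e | e dvd k. ?g e)" if k: "k dvd m" for k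
  proof -
    have "k > 0" using k assms(2) by (auto intro: Nat.gr0I)
    have quotient: "k div e * (j * (m div k)) = j * (m div e)" if "e dvd k" for e
    proof -
      from that k obtain b c where "k = e * b" "m = e * b * c" by (auto elim!: dvdE)
      then show ?thesis using \<open>k > 0\<close> by simp
    qed
    have "?f k = (\<Sum>w | set w \<subseteq> A \<and> length w = k. prod_list (map x w) ^ (j * (m div k)))"
      unfolding sum_prod_list_words[OF assms(1), symmetric] by (simp add: prod_list_map_power)
    also have "\<dots> = (\<Sum>(e, u)\<in>(SIGMA e:{e. e dvd k}. primitive_words e A).
        prod_list (map x (concat (replicate (k div e) u))) ^ (j * (m div k)))"
      by (subst sum.reindex_bij_betw[OF bij_betw_primitive_powers[OF \<open>k > 0\<close>], symmetric])
        (simp add: case_prod_unfold)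
    also have "\<dots> = (\<Sum>e | e dvd k. ?g e)"
      using \<open>k > 0\<close> finite_primitive_words[OF assms(1)]
      by (subst sum.Sigma[symmetric])
        (auto simp: prod_list_map_concat_replicate quotient simp flip: power_mult)
    finally show ?thesis .
  qed
  then have "?g m = (\<Sum>d | d dvd m. of_int (moebius d) * ?f (m div d))"
    by (rule moebius_inversion[OF assms(2)])
  moreover have "m div (m div d) = d" if "d dvd m" for d
    using that assms(2) by (auto elim!: dvdE)
  ultimately show ?thesis using assms(2) by simp
qed

section \<open>Permutations with cycles of equal length\<close>

definition uniform_perms :: "nat \<Rightarrow> nat \<Rightarrow> (nat \<Rightarrow> nat) set" where
  "uniform_perms m n = {p. p permutes {1..n} \<and> (\<forall>i\<in>{1..n}. least_power p i = m)}"

lemma finite_uniform_perms: "finite (uniform_perms m n)"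
  by (rule finite_subset[OF _ finite_permutations[of "{1..n}"]]) (auto simp: uniform_perms_def)

lemma orbit_eq_set_support: "permutation p \<Longrightarrow> orbit p i = set (support p i)"
  unfolding support_set orbit_altdef_permutation by auto

lemma card_orbit_eq_least_power: "permutation p \<Longrightarrow> card (orbit p i) = least_power p i"
  using distinct_card[OF cycle_of_permutation] by (simp add: orbit_eq_set_support)

lemma cycle_type_eq_replicate_iff:
  assumes "p permutes S" "finite S" "card S = m * r" "m > 0"
  shows "cycle_type p S = replicate_mset r m \<longleftrightarrow> (\<forall>i\<in>S. least_power p i = m)"
proof -
  have p: "permutation p" using assms(1,2) by (auto simp: permutation_permutes)
  show ?thesis
  proof
    assume "cycle_type p S = replicate_mset r m"
    then have "set_mset (cycle_type p S) \<subseteq> {m}" by auto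
    then have "card ` orbit p ` S \<subseteq> {m}" using assms(2) by (simp add: cycle_type_def)
    then show "\<forall>i\<in>S. least_power p i = m"
      by (simp add: image_subset_iff card_orbit_eq_least_power[OF p])
  next
    assume uniform: "\<forall>i\<in>S. least_power p i = m"
    have union: "\<Union> (orbit p ` S) = S"
      using permutes_orbit_subset[OF assms(1)] permutation_self_in_orbit[OF p] by blast
    have "m * card (orbit p ` S) = card (\<Union> (orbit p ` S))"
    proof (rule card_partition)
      fix C D assume "C \<in> orbit p ` S" "D \<in> orbit p ` S" "C \<noteq> D"
      then show "C \<inter> D = {}"
        using disjointD[OF disjoint_support[OF p]] by (auto simp: orbit_eq_set_support[OF p])
    qed (use assms(2) uniform union card_orbit_eq_least_power[OF p] in auto)
    then have "card (orbit p ` S) = r" using union assms(3,4) by simp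
    moreover have "cycle_type p S = image_mset (\<lambda>_. m) (mset_set (orbit p ` S))"
      unfolding cycle_type_def
      by (rule image_mset_cong) (use uniform assms(2) card_orbit_eq_least_power[OF p] in auto)
    ultimately show "cycle_type p S = replicate_mset r m"
      by (simp add: image_mset_const_eq)
  qed
qed

section \<open>Monotone lifts\<close>

text \<open>Both directions of the Gessel-Reutenauer correspondence come from the monotone lift of
  \<open>rotate1\<close> along a map to words.\<close>

definition monotone_lift :: "'i::linorder set \<Rightarrow> ('i \<Rightarrow> 'b) \<Rightarrow> ('b \<Rightarrow> 'b) \<Rightarrow> ('i \<Rightarrow> 'i) \<Rightarrow> bool" where
  "monotone_lift I W \<rho> p \<longleftrightarrow> p permutes I \<and> (\<forall>i\<in>I. W (p i) = \<rho> (W i)) \<and>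
     (\<forall>w. strict_mono_on {i \<in> I. W i = w} p)"

lemma strict_mono_on_eq_if_same_image:
  fixes g h :: "'a::linorder \<Rightarrow> 'b::linorder"
  assumes "finite A" "strict_mono_on A g" "strict_mono_on A h" "g ` A = h ` A" "x \<in> A"
  shows "g x = h x"
proof -
  have map_sorted: "map k (sorted_list_of_set A) = sorted_list_of_set (k ` A)"
    if k: "strict_mono_on A k" for k :: "'a \<Rightarrow> 'b"
  proof (rule sorted_distinct_set_unique)
    show "distinct (map k (sorted_list_of_set A))"
      using strict_mono_on_imp_inj_on[OF k] assms(1) by (simp add: distinct_map)
    have "sorted_wrt (<) (sorted_list_of_set A)" by simp
    then show "sorted (map k (sorted_list_of_set A))"
      unfolding sorted_wrt_map by (rule sorted_wrt_mono_rel[rotated])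
        (use k assms(1) in \<open>auto simp: strict_mono_on_def less_imp_le\<close>)
  qed (use assms(1) in auto)
  have "map g (sorted_list_of_set A) = map h (sorted_list_of_set A)"
    using map_sorted[OF assms(2)] map_sorted[OF assms(3)] assms(4) by simp
  then show ?thesis using assms(1,5) by simp
qed

lemma ex_strict_mono_on_image_eq:
  fixes A :: "'a::linorder set" and B :: "'b::linorder set"
  assumes "finite A" "finite B" "card A = card B"
  shows "\<exists>g. strict_mono_on A g \<and> g ` A = B"
proof -
  define rank where "rank x = card {y \<in> A. y < x}" for x
  have rank_less: "rank x < rank y" if "x \<in> A" "x < y" for x y
  proof -
    have "{z \<in> A. z < x} \<subset> {z \<in> A. z < y}" using that by fastforce
    then show ?thesis unfolding rank_def using assms(1) by (intro psubset_card_mono) simp_all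
  qed
  have rank_bound: "rank x < card B" if "x \<in> A" for x
  proof -
    have "{z \<in> A. z < x} \<subset> A" using that by blast
    then show ?thesis
      unfolding rank_def assms(3)[symmetric] by (rule psubset_card_mono[OF assms(1)])
  qed
  define g where "g x = sorted_list_of_set B ! rank x" for x
  have g_mono: "strict_mono_on A g"
  proof (rule strict_mono_onI)
    fix x y assume "x \<in> A" "y \<in> A" "x < y"
    then show "g x < g y"
      unfolding g_def by (intro sorted_wrt_nth_less[of "(<)"]) (simp_all add: rank_less rank_bound)
  qed
  have "g x \<in> B" if "x \<in> A" for x
  proof -
    have "g x \<in> set (sorted_list_of_set B)"
      unfolding g_def using rank_bound[OF that] by (intro nth_mem) simp
    then show ?thesis using assms(2) by simp
  qed
  then have "g ` A \<subseteq> B" by blast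
  moreover have "card (g ` A) = card B"
    using card_image[OF strict_mono_on_imp_inj_on[OF g_mono]] assms(3) by simp
  ultimately have "g ` A = B" using card_subset_eq[OF assms(2)] by blast
  then show ?thesis using g_mono by blast
qed

lemma count_image_mset_inj: "inj f \<Longrightarrow> count (image_mset f M) (f x) = count M x"
  by (induction M) (auto simp: inj_eq)

lemma count_image_mset_set:
  "finite I \<Longrightarrow> count (image_mset W (mset_set I)) w = card {i \<in> I. W i = w}"
  by (simp add: count_image_mset vimage_def Int_def conj_commute)

context
  fixes I :: "'i::linorder set" and W :: "'i \<Rightarrow> 'b" and \<rho> :: "'b \<Rightarrow> 'b"
  assumes finite_I: "finite I"
begin

abbreviation (input) "level w \<equiv> {i \<in> I. W i = w}"

lemma monotone_lift_funpow:
  assumes p: "monotone_lift I W \<rho> p"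
  shows "(p ^^ s) ` level w \<subseteq> level ((\<rho> ^^ s) w)" "strict_mono_on (level w) (p ^^ s)"
proof -
  have step: "p ` level w \<subseteq> level (\<rho> w)" for w
    using p by (auto simp: monotone_lift_def permutes_in_image)
  show image: "(p ^^ s) ` level w \<subseteq> level ((\<rho> ^^ s) w)" for s w
  proof (induction s)
    case (Suc s)
    then have "p ` (p ^^ s) ` level w \<subseteq> p ` level ((\<rho> ^^ s) w)" by blast
    also have "\<dots> \<subseteq> level (\<rho> ((\<rho> ^^ s) w))" by (rule step)
    finally show ?case by (simp add: image_image)
  qed simp
  show "strict_mono_on (level w) (p ^^ s)"
  proof (induction s)
    case (Suc s)
    have "strict_mono_on (level ((\<rho> ^^ s) w)) p" using p by (simp add: monotone_lift_def)
    then show ?case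
      using Suc image[of s w] unfolding strict_mono_on_def by (auto simp: image_subset_iff)
  qed (simp add: strict_mono_on_def)
qed

lemma monotone_lift_funpow_eq_self_iff:
  assumes p: "monotone_lift I W \<rho> p" and i: "i \<in> I"
  shows "(p ^^ s) i = i \<longleftrightarrow> (\<rho> ^^ s) (W i) = W i"
proof
  assume "(p ^^ s) i = i"
  then show "(\<rho> ^^ s) (W i) = W i" using monotone_lift_funpow(1)[OF p, of s "W i"] i by auto
next
  let ?L = "level (W i)"
  have mono: "strict_mono_on ?L (p ^^ s)" by (rule monotone_lift_funpow(2)[OF p])
  assume "(\<rho> ^^ s) (W i) = W i"
  then have "(p ^^ s) ` ?L \<subseteq> ?L" using monotone_lift_funpow(1)[OF p, of s "W i"] by simp
  then have "(p ^^ s) ` ?L = ?L"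
    using finite_I strict_mono_on_imp_inj_on[OF mono] by (intro endo_inj_surj) auto
  then show "(p ^^ s) i = i"
    using strict_mono_on_eq_if_same_image[OF _ mono, of id i] finite_I i
    by (simp add: strict_mono_on_def)
qed

lemma least_power_monotone_lift:
  "monotone_lift I W \<rho> p \<Longrightarrow> i \<in> I \<Longrightarrow> least_power p i = least_power \<rho> (W i)"
  unfolding least_power_def by (simp add: monotone_lift_funpow_eq_self_iff)

lemma monotone_lift_image:
  assumes p: "monotone_lift I W \<rho> p" and "inj \<rho>"
  shows "p ` level w = level (\<rho> w)"
proof
  show "p ` level w \<subseteq> level (\<rho> w)" using monotone_lift_funpow(1)[OF p, of 1] by simp
  show "level (\<rho> w) \<subseteq> p ` level w"
  proof
    fix j assume j: "j \<in> level (\<rho> w)"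
    then obtain i where i: "i \<in> I" "j = p i"
      using p permutes_image[of p I] by (force simp: monotone_lift_def)
    then have "\<rho> (W i) = \<rho> w" using j p by (simp add: monotone_lift_def)
    then show "j \<in> p ` level w" using i assms(2) by (auto dest: injD)
  qed
qed

lemma monotone_lift_unique:
  assumes p: "monotone_lift I W \<rho> p" and q: "monotone_lift I W \<rho> q" and "inj \<rho>"
  shows "p = q"
proof
  fix i
  show "p i = q i"
  proof (cases "i \<in> I")
    case True
    have "strict_mono_on (level (W i)) p" "strict_mono_on (level (W i)) q"
      using p q by (simp_all add: monotone_lift_def)
    moreover have "p ` level (W i) = q ` level (W i)"
      using monotone_lift_image[OF _ \<open>inj \<rho>\<close>] p q by simp
    ultimately show ?thesis
      using True finite_I
      by (intro strict_mono_on_eq_if_same_image[of "level (W i)" p q]) simp_all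
  qed (use p q in \<open>auto simp: monotone_lift_def permutes_not_in\<close>)
qed

lemma monotone_lift_exists:
  assumes "inj \<rho>" and invariant: "image_mset (\<rho> \<circ> W) (mset_set I) = image_mset W (mset_set I)"
  shows "\<exists>p. monotone_lift I W \<rho> p"
proof -
  have "card (level (\<rho> w)) = card (level w)" for w
    using count_image_mset_inj[OF \<open>inj \<rho>\<close>, of "image_mset W (mset_set I)" w] invariant
    by (simp add: multiset.map_comp count_image_mset_set[OF finite_I])
  then have "\<exists>g. strict_mono_on (level w) g \<and> g ` level w = level (\<rho> w)" for w
    using finite_I by (intro ex_strict_mono_on_image_eq) auto
  then obtain g where g: "strict_mono_on (level w) (g w)" "g w ` level w = level (\<rho> w)" for w
    using choice[of "\<lambda>w g. strict_mono_on (level w) g \<and> g ` level w = level (\<rho> w)"] by blast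
  define p where "p i = (if i \<in> I then g (W i) i else i)" for i
  have p_mono: "strict_mono_on (level w) p" for w
    using g(1)[of w] by (simp add: strict_mono_on_def p_def)
  have p_in: "p i \<in> I" "W (p i) = \<rho> (W i)" if "i \<in> I" for i
  proof -
    have "p i \<in> g (W i) ` level (W i)" using that by (simp add: p_def)
    then have "p i \<in> level (\<rho> (W i))" by (simp only: g(2))
    then show "p i \<in> I" "W (p i) = \<rho> (W i)" by simp_all
  qed
  have "inj_on p I"
  proof (rule inj_onI)
    fix i j assume ij: "i \<in> I" "j \<in> I" "p i = p j"
    then have "\<rho> (W i) = \<rho> (W j)" using p_in(2)[of i] p_in(2)[of j] by simp
    then have "W i = W j" by (rule injD[OF \<open>inj \<rho>\<close>])
    then show "i = j"
      using ij inj_onD[OF strict_mono_on_imp_inj_on[OF p_mono[of "W j"]], of i j] by simp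
  qed
  moreover from this have "p ` I = I"
    using p_in(1) finite_I by (intro endo_inj_surj) (simp_all add: image_subset_iff)
  ultimately have "p permutes I"
    by (intro bij_imp_permutes) (simp_all add: bij_betw_def p_def)
  then have "monotone_lift I W \<rho> p" using p_in p_mono by (simp add: monotone_lift_def)
  then show ?thesis by blast
qed

end

section \<open>The Gessel-Reutenauer correspondence\<close>

definition compatible_words :: "nat \<Rightarrow> (nat \<Rightarrow> nat) \<Rightarrow> 'a::linorder set \<Rightarrow> (nat \<Rightarrow> 'a) set" where
  "compatible_words n p A = {f \<in> {1..n} \<rightarrow>\<^sub>E A.
     \<forall>i\<in>{1..<n}. f i < f (Suc i) \<or> f i = f (Suc i) \<and> p i < p (Suc i)}"

definition gr_pairs :: "nat \<Rightarrow> nat \<Rightarrow> 'a::linorder set \<Rightarrow> ((nat \<Rightarrow> nat) \<times> (nat \<Rightarrow> 'a)) set" where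
  "gr_pairs m n A = (SIGMA p:uniform_perms m n. compatible_words n p A)"

definition itinerary :: "nat \<Rightarrow> (nat \<Rightarrow> nat) \<Rightarrow> (nat \<Rightarrow> 'a) \<Rightarrow> nat \<Rightarrow> 'a list" where
  "itinerary k p f i = map (\<lambda>s. f ((p ^^ s) i)) [0..<k]"

definition gr_mset :: "nat \<Rightarrow> nat \<Rightarrow> (nat \<Rightarrow> nat) \<times> (nat \<Rightarrow> 'a) \<Rightarrow> 'a list multiset" where
  "gr_mset m n = (\<lambda>(p, f). image_mset (itinerary m p f) (mset_set {1..n}))"

definition necklace_msets :: "nat \<Rightarrow> 'a set \<Rightarrow> nat \<Rightarrow> 'a list multiset set" where
  "necklace_msets m A n =
     {M. set_mset M \<subseteq> primitive_words m A \<and> image_mset rotate1 M = M \<and> size M = n}"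

lemma inj_rotate1: "inj rotate1"
proof (rule injI)
  fix u v :: "'a list"
  assume "rotate1 u = rotate1 v"
  then show "u = v" by (cases u; cases v) auto
qed

lemma length_itinerary [simp]: "length (itinerary k p f i) = k"
  by (simp add: itinerary_def)

lemma itinerary_Suc: "itinerary (Suc k) p f i = f i # itinerary k p f (p i)"
  unfolding itinerary_def map_upt_Suc by (simp add: funpow_swap1)

lemma hd_itinerary: "k > 0 \<Longrightarrow> hd (itinerary k p f i) = f i"
  by (cases k) (simp_all add: itinerary_Suc)

lemma itinerary_image:
  assumes "(p ^^ k) i = i"
  shows "itinerary k p f (p i) = rotate1 (itinerary k p f i)"
proof (cases k)
  case (Suc j)
  have "itinerary k p f (p i) = itinerary j p f (p i) @ [f ((p ^^ j) (p i))]"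
    by (simp add: Suc itinerary_def)
  then show ?thesis using assms by (simp add: Suc itinerary_Suc funpow_swap1)
qed (simp add: itinerary_def)

lemma compatible_words_less:
  assumes f: "f \<in> compatible_words n p A" and ij: "1 \<le> i" "i < j" "j \<le> n"
  shows "f i < f j \<or> f i = f j \<and> p i < p j"
  using ij(2,1,3)
proof (induction i j rule: less_Suc_induct)
  case (1 k)
  then show ?case using f by (auto simp: compatible_words_def)
qed auto

lemma compatible_words_mono:
  assumes "f \<in> compatible_words n p A"
  shows "mono_on {1..n} f"
proof (rule mono_onI)
  fix i j assume "i \<in> {1..n}" "j \<in> {1..n}" "i \<le> j"
  then show "f i \<le> f j"
    using compatible_words_less[OF assms, of i j] by (cases "i = j") auto
qed

context
  fixes m n :: nat and p :: "nat \<Rightarrow> nat" and f :: "nat \<Rightarrow> 'a::linorder" and A :: "'a set"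
  assumes m: "m > 0" and pf: "(p, f) \<in> gr_pairs m n A"
begin

lemma gr_pairs_uniform: "p permutes {1..n}" "\<And>i. i \<in> {1..n} \<Longrightarrow> least_power p i = m"
  and gr_pairs_compatible: "f \<in> compatible_words n p A"
  using pf by (auto simp: gr_pairs_def uniform_perms_def)

lemma gr_pairs_funpow_in: "i \<in> {1..n} \<Longrightarrow> (p ^^ s) i \<in> {1..n}"
  using permutes_in_image[OF permutes_funpow[OF gr_pairs_uniform(1)]] by blast

lemma itinerary_rotate1: "i \<in> {1..n} \<Longrightarrow> itinerary m p f (p i) = rotate1 (itinerary m p f i)"
  using gr_pairs_uniform least_power_of_permutation(1)[of p i]
  by (intro itinerary_image) (auto simp: permutation_permutes)

lemma mono_on_itinerary: "mono_on {1..n} (itinerary k p f)"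
proof (induction k)
  case (Suc k)
  show ?case
  proof (rule mono_onI)
    fix i j assume ij: "i \<in> {1..n}" "j \<in> {1..n}" "i \<le> j"
    then have "p i \<in> {1..n}" "p j \<in> {1..n}" using gr_pairs_funpow_in[of _ 1] by simp_all
    then have "itinerary k p f (p i) \<le> itinerary k p f (p j)" if "p i \<le> p j"
      using mono_onD[OF Suc] that by blast
    moreover have "i = j \<or> f i < f j \<or> f i = f j \<and> p i < p j"
      using compatible_words_less[OF gr_pairs_compatible, of i j] ij by auto
    ultimately show "itinerary (Suc k) p f i \<le> itinerary (Suc k) p f j"
      by (auto simp: itinerary_Suc)
  qed
qed (simp add: itinerary_def mono_on_def)

lemma monotone_lift_itinerary: "monotone_lift {1..n} (itinerary m p f) rotate1 p"
  unfolding monotone_lift_def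
proof (intro conjI allI ballI)
  fix w
  show "strict_mono_on {i \<in> {1..n}. itinerary m p f i = w} p"
  proof (rule strict_mono_onI)
    fix i j
    assume ij: "i \<in> {i \<in> {1..n}. itinerary m p f i = w}" "j \<in> {i \<in> {1..n}. itinerary m p f i = w}"
      "i < j"
    then have "hd (itinerary m p f i) = hd (itinerary m p f j)" by simp
    then have "f i = f j" by (simp only: hd_itinerary[OF m])
    then show "p i < p j" using compatible_words_less[OF gr_pairs_compatible, of i j] ij by auto
  qed
qed (use gr_pairs_uniform(1) itinerary_rotate1 in auto)

lemma gr_mset_in_necklace_msets: "gr_mset m n (p, f) \<in> necklace_msets m A n"
proof -
  have "itinerary m p f i \<in> primitive_words m A" if i: "i \<in> {1..n}" for i
  proof -
    have "least_power rotate1 (itinerary m p f i) = m"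
      using least_power_monotone_lift[OF _ monotone_lift_itinerary i] gr_pairs_uniform(2)[OF i]
      by simp
    moreover have "set (itinerary m p f i) \<subseteq> A"
      using gr_pairs_compatible gr_pairs_funpow_in[OF i]
      by (auto simp: itinerary_def compatible_words_def)
    ultimately show ?thesis by (simp add: primitive_words_def)
  qed
  moreover have "image_mset rotate1 (gr_mset m n (p, f)) =
      image_mset (itinerary m p f) (image_mset p (mset_set {1..n}))"
    by (auto simp: gr_mset_def multiset.map_comp itinerary_rotate1 intro!: image_mset_cong)
  ultimately show ?thesis
    using image_mset_mset_set[OF permutes_inj_on[OF gr_pairs_uniform(1)]]
      permutes_image[OF gr_pairs_uniform(1)]
    by (auto simp: necklace_msets_def gr_mset_def)
qed

end

lemma mono_on_eq_if_same_mset: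
  fixes W V :: "nat \<Rightarrow> 'a::linorder"
  assumes "mono_on {1..n} W" "mono_on {1..n} V"
    and "image_mset W (mset_set {1..n}) = image_mset V (mset_set {1..n})" and "i \<in> {1..n}"
  shows "W i = V i"
proof -
  have sorted: "map U [1..<Suc n] = sorted_list_of_multiset (image_mset U (mset_set {1..n}))"
    if "mono_on {1..n} U" for U :: "nat \<Rightarrow> 'a"
  proof -
    have "sorted_wrt (<) [1..<Suc n]" by (rule sorted_wrt_upt)
    then have "sorted (map U [1..<Suc n])"
      unfolding sorted_wrt_map
      by (rule sorted_wrt_mono_rel[rotated]) (use that in \<open>auto simp: mono_on_def\<close>)
    moreover have "image_mset U (mset_set {1..n}) = mset (map U [1..<Suc n])"
      by (metis atLeastLessThanSuc_atLeastAtMost mset_map mset_upt)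
    ultimately show ?thesis by (metis sorted_list_of_multiset_mset sorted_sort_id)
  qed
  have "map W [1..<Suc n] = map V [1..<Suc n]"
    using sorted[OF assms(1)] sorted[OF assms(2)] assms(3) by simp
  then show ?thesis using assms(4) unfolding map_eq_conv by (simp del: upt_Suc)
qed

lemma ex_mono_on_image_mset_eq:
  fixes M :: "'a::linorder multiset"
  shows "\<exists>W. mono_on {1..size M} W \<and> image_mset W (mset_set {1..size M}) = M"
proof (intro exI conjI)
  let ?xs = "sorted_list_of_multiset M"
  let ?W = "\<lambda>i. ?xs ! (i - 1)"
  have length: "length ?xs = size M" by (metis mset_sorted_list_of_multiset size_mset)
  show "mono_on {1..size M} ?W"
    by (intro mono_onI sorted_nth_mono) (auto simp: length)
  have "mset_set {1..size M} = image_mset Suc (mset_set {0..<size M})"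
    by (simp add: image_mset_mset_set atLeastLessThanSuc_atLeastAtMost)
  then have "image_mset ?W (mset_set {1..size M}) = mset (map ((!) ?xs) [0..<size M])"
    by (simp add: multiset.map_comp o_def)
  also have "\<dots> = M" using map_nth[of ?xs] length by simp
  finally show "image_mset ?W (mset_set {1..size M}) = M" .
qed

lemma inj_on_gr_mset:
  assumes "m > 0"
  shows "inj_on (gr_mset m n) (gr_pairs m n A)"
proof (rule inj_onI, clarify)
  fix p f p' f'
  assume pf: "(p, f) \<in> gr_pairs m n A" and pf': "(p', f') \<in> gr_pairs m n A"
    and same_mset: "gr_mset m n (p, f) = gr_mset m n (p', f')"
  have itinerary_eq: "itinerary m p f i = itinerary m p' f' i" if "i \<in> {1..n}" for i
    using mono_on_eq_if_same_mset[OF mono_on_itinerary[OF assms pf] mono_on_itinerary[OF assms pf']]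
      same_mset that by (simp add: gr_mset_def)
  have "f i = f' i" for i
  proof (cases "i \<in> {1..n}")
    case True
    then show ?thesis using itinerary_eq hd_itinerary[OF assms] by metis
  next
    case False
    then show ?thesis
      using pf pf' by (auto simp: gr_pairs_def compatible_words_def PiE_def extensional_def)
  qed
  moreover have "monotone_lift {1..n} (itinerary m p f) rotate1 p'"
  proof -
    have "{i \<in> {1..n}. itinerary m p f i = w} = {i \<in> {1..n}. itinerary m p' f' i = w}" for w
      using itinerary_eq by auto
    moreover have "p' i \<in> {1..n}" if "i \<in> {1..n}" for i
      using gr_pairs_funpow_in[OF assms pf', of _ 1] that by simp
    ultimately show ?thesis
      using monotone_lift_itinerary[OF assms pf'] itinerary_eq by (simp add: monotone_lift_def)
  qed
  then have "p = p'"
    using monotone_lift_unique[OF _ monotone_lift_itinerary[OF assms pf] _ inj_rotate1] by blast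
  ultimately show "p = p' \<and> f = f'" by auto
qed

lemma itinerary_hd_eq:
  assumes i: "i \<in> I" and closed: "\<And>i. i \<in> I \<Longrightarrow> p i \<in> I"
    and W: "\<And>i. i \<in> I \<Longrightarrow> W (p i) = rotate1 (W i)" and f: "\<And>i. i \<in> I \<Longrightarrow> f i = hd (W i)"
  shows "itinerary (length (W i)) p f i = W i"
proof (rule nth_equalityI)
  fix s assume s: "s < length (itinerary (length (W i)) p f i)"
  have "(p ^^ s) i \<in> I \<and> W ((p ^^ s) i) = rotate s (W i)" for s
    by (induction s) (simp_all add: i closed W)
  then have "f ((p ^^ s) i) = hd (rotate s (W i))" by (simp add: f)
  also have "\<dots> = W i ! s" using s by (subst hd_rotate_conv_nth) auto
  finally show "itinerary (length (W i)) p f i ! s = W i ! s" using s by (simp add: itinerary_def)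
qed simp

lemma rotate1_less_if_hd_eq:
  fixes u v :: "'a::linorder list"
  assumes "length u = length v" "u < v" "hd u = hd v"
  shows "rotate1 u < rotate1 v"
proof -
  obtain a x y where "u = a # x" "v = a # y"
    using assms by (cases u; cases v) auto
  then show ?thesis
    using assms by (simp add: list_less_def lexord_append_leftI lexord_sufI)
qed

lemma compatible_words_hd:
  fixes W :: "nat \<Rightarrow> 'a::linorder list"
  assumes W_mono: "mono_on {1..n} W" and W: "\<And>i. i \<in> {1..n} \<Longrightarrow> W i \<in> primitive_words m A"
    and m: "m > 0" and p: "monotone_lift {1..n} W rotate1 p"
  shows "restrict (hd \<circ> W) {1..n} \<in> compatible_words n p A"
proof -
  have W_length: "length (W i) = m" if "i \<in> {1..n}" for i
    using W[OF that] by (simp add: primitive_words_def)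
  have "hd (W i) \<in> A" if "i \<in> {1..n}" for i
    using W[OF that] m by (auto simp: primitive_words_def intro: hd_in_set)
  moreover have "hd (W i) < hd (W (Suc i)) \<or> hd (W i) = hd (W (Suc i)) \<and> p i < p (Suc i)"
    if i: "i \<in> {1..<n}" for i
  proof -
    have i': "i \<in> {1..n}" "Suc i \<in> {1..n}" using i by auto
    then have W_le: "W i \<le> W (Suc i)" using mono_onD[OF W_mono] by simp
    then have "hd (W i) \<le> hd (W (Suc i))"
      using W_length[OF i'(1)] W_length[OF i'(2)] m by (cases "W i"; cases "W (Suc i)") auto
    moreover have "p i < p (Suc i)" if hd_eq: "hd (W i) = hd (W (Suc i))"
    proof (cases "W i = W (Suc i)")
      case True
      then show ?thesis using p i' by (auto simp: monotone_lift_def strict_mono_on_def)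
    next
      case False
      then have "rotate1 (W i) < rotate1 (W (Suc i))"
        using W_le hd_eq W_length i' by (intro rotate1_less_if_hd_eq) auto
      then have less: "W (p i) < W (p (Suc i))" using p i' by (simp add: monotone_lift_def)
      have "p i \<in> {1..n}" "p (Suc i) \<in> {1..n}"
        using p i' by (auto simp: monotone_lift_def permutes_in_image simp del: atLeastAtMost_iff)
      then show ?thesis using mono_onD[OF W_mono] less by (meson leD not_le)
    qed
    ultimately show ?thesis by (auto simp: order_le_less)
  qed
  ultimately show ?thesis by (auto simp: compatible_words_def)
qed

lemma necklace_mset_in_gr_mset_image:
  fixes A :: "'a::linorder set"
  assumes m: "m > 0" and M: "M \<in> necklace_msets m A n"
  shows "M \<in> gr_mset m n ` gr_pairs m n A"
proof -
  obtain W where W_mono: "mono_on {1..n} W" and M_eq: "image_mset W (mset_set {1..n}) = M"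
    using ex_mono_on_image_mset_eq[of M] M by (auto simp: necklace_msets_def)
  have W: "W i \<in> primitive_words m A" if "i \<in> {1..n}" for i
    using M that unfolding M_eq[symmetric] by (auto simp: necklace_msets_def)
  have "image_mset (rotate1 \<circ> W) (mset_set {1..n}) = image_mset W (mset_set {1..n})"
    using M unfolding M_eq[symmetric] by (simp add: necklace_msets_def multiset.map_comp)
  then obtain p where p: "monotone_lift {1..n} W rotate1 p"
    using monotone_lift_exists[OF _ inj_rotate1] by blast
  then have perm: "p permutes {1..n}" and W_p: "\<And>i. i \<in> {1..n} \<Longrightarrow> W (p i) = rotate1 (W i)"
    by (auto simp: monotone_lift_def)
  let ?f = "restrict (hd \<circ> W) {1..n}"
  have "least_power p i = m" if "i \<in> {1..n}" for i
    using least_power_monotone_lift[OF _ p that] W[OF that] by (simp add: primitive_words_def)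
  then have "(p, ?f) \<in> gr_pairs m n A"
    using perm compatible_words_hd[OF W_mono W m p] by (simp add: gr_pairs_def uniform_perms_def)
  moreover have "itinerary m p ?f i = W i" if i: "i \<in> {1..n}" for i
  proof -
    have "p j \<in> {1..n}" if "j \<in> {1..n}" for j using permutes_in_image[OF perm] that by blast
    then have "itinerary (length (W i)) p ?f i = W i"
      by (intro itinerary_hd_eq[OF i]) (simp_all add: W_p)
    then show ?thesis using W[OF i] by (simp add: primitive_words_def)
  qed
  then have "gr_mset m n (p, ?f) = M"
    unfolding M_eq[symmetric] gr_mset_def by (auto intro: image_mset_cong)
  ultimately show ?thesis by force
qed

theorem bij_betw_gr_mset:
  assumes "m > 0"
  shows "bij_betw (gr_mset m n) (gr_pairs m n A) (necklace_msets m A n)"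
  unfolding bij_betw_def
proof (intro conjI equalityI)
  show "gr_mset m n ` gr_pairs m n A \<subseteq> necklace_msets m A n"
    using gr_mset_in_necklace_msets[OF assms] by auto
  show "necklace_msets m A n \<subseteq> gr_mset m n ` gr_pairs m n A"
    using necklace_mset_in_gr_mset_image[OF assms] by blast
qed (rule inj_on_gr_mset[OF assms])

section \<open>Weighted multisets of necklaces\<close>

definition rotations :: "'a list \<Rightarrow> 'a list set" where
  "rotations w = range (\<lambda>s. rotate s w)"

definition head_weight :: "('a \<Rightarrow> 'b::comm_semiring_1) \<Rightarrow> 'a list multiset \<Rightarrow> 'b" where
  "head_weight x M = (\<Prod>w\<in>#M. x (hd w))"

definition necklace_sum :: "nat \<Rightarrow> 'a set \<Rightarrow> ('a \<Rightarrow> 'b::comm_semiring_1) \<Rightarrow> nat \<Rightarrow> 'b" where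
  "necklace_sum m A x r = (\<Sum>M\<in>necklace_msets m A (m * r). head_weight x M)"

lemma inj_rotate: "inj (rotate s)"
  unfolding rotate_def by (rule inj_fn[OF inj_rotate1])

lemma rotations_subset_primitive_words:
  assumes "w \<in> primitive_words m A"
  shows "rotations w \<subseteq> primitive_words m A"
proof -
  have "rotate t (rotate s w) = rotate s w \<longleftrightarrow> rotate t w = w" for s t
    using inj_rotate[of s] by (metis add.commute injD rotate_rotate)
  then have "least_power rotate1 (rotate s w) = least_power rotate1 w" for s
    by (simp add: least_power_def flip: rotate_def)
  then show ?thesis using assms by (auto simp: rotations_def primitive_words_def)
qed

lemma bij_betw_rotations:
  assumes "w \<in> primitive_words m A" "m > 0"
  shows "bij_betw (\<lambda>s. rotate s w) {..<m} (rotations w)"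
  unfolding bij_betw_def
proof
  have m: "least_power rotate1 w = m" "length w = m"
    using assms(1) by (simp_all add: primitive_words_def)
  show "inj_on (\<lambda>s. rotate s w) {..<m}"
  proof (rule linorder_inj_onI)
    fix s t assume st: "s < t" "s \<in> {..<m}" "t \<in> {..<m}"
    show "rotate s w \<noteq> rotate t w"
    proof
      assume "rotate s w = rotate t w"
      then have "rotate s w = rotate s (rotate (t - s) w)" using st by (simp add: rotate_rotate)
      then have "rotate (t - s) w = w" by (metis injD inj_rotate)
      then have "m dvd t - s" by (simp add: rotate_eq_self_iff m)
      then show False using st by (auto dest: dvd_imp_le)
    qed
  qed auto
  have "rotate s w \<in> (\<lambda>s. rotate s w) ` {..<m}" for s
    using assms(2) rotate_conv_mod[of s w] m by (intro image_eqI[of _ _ "s mod m"]) auto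
  then show "(\<lambda>s. rotate s w) ` {..<m} = rotations w" by (auto simp: rotations_def)
qed

lemma finite_rotations: "finite (rotations w)"
  by (rule finite_subset[OF _ finite_lists_length_eq[of "set w" "length w"]])
    (auto simp: rotations_def)

lemma rotate1_image_rotations: "rotate1 ` rotations w = rotations w"
proof (rule endo_inj_surj[OF finite_rotations])
  have "rotate1 (rotate s w) = rotate (Suc s) w" for s by simp
  then show "rotate1 ` rotations w \<subseteq> rotations w" unfolding rotations_def by blast
qed (rule inj_on_subset[OF inj_rotate1 subset_UNIV])

lemma image_rotate1_repeat_rotations:
  "image_mset rotate1 (repeat_mset j (mset_set (rotations w))) =
    repeat_mset j (mset_set (rotations w))"
  by (induction j)
    (simp_all add: image_mset_mset_set inj_on_subset[OF inj_rotate1] rotate1_image_rotations)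

lemma head_weight_add: "head_weight x (M + N) = head_weight x M * head_weight x N"
  by (simp add: head_weight_def)

lemma head_weight_repeat_rotations:
  assumes "w \<in> primitive_words m A" "m > 0"
  shows "head_weight x (repeat_mset j (mset_set (rotations w))) = prod_list (map x w) ^ j"
proof -
  have "head_weight x (mset_set (rotations w)) = (\<Prod>s<m. x (hd (rotate s w)))"
    unfolding head_weight_def prod_unfold_prod_mset[symmetric]
    by (rule prod.reindex_bij_betw[OF bij_betw_rotations[OF assms], symmetric])
  also have "\<dots> = (\<Prod>s<length w. x (w ! s))"
  proof (rule prod.cong)
    fix s assume "s \<in> {..<length w}"
    then have "hd (rotate s w) = w ! s" by (subst hd_rotate_conv_nth) auto
    then show "x (hd (rotate s w)) = x (w ! s)" by simp
  qed (use assms(1) in \<open>simp add: primitive_words_def\<close>)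
  also have "\<dots> = prod_list (map x w)" by (simp add: prod.list_conv_set_nth lessThan_atLeast0)
  finally show ?thesis by (induction j) (simp_all add: head_weight_add, simp add: head_weight_def)
qed

lemma count_rotate_necklace_msets:
  assumes "M \<in> necklace_msets m A n"
  shows "count M (rotate s w) = count M w"
proof (induction s)
  case (Suc s)
  have "count M (rotate1 (rotate s w)) = count M (rotate s w)"
    using count_image_mset_inj[OF inj_rotate1, of M "rotate s w"] assms
    by (simp add: necklace_msets_def)
  then show ?case using Suc by simp
qed simp

lemma repeat_rotations_subseteq_iff:
  assumes M: "M \<in> necklace_msets m A n"
  shows "repeat_mset j (mset_set (rotations w)) \<subseteq># M \<longleftrightarrow> j \<le> count M w"
proof -
  let ?R = "repeat_mset j (mset_set (rotations w))"
  have count_R: "count ?R v = (if v \<in> rotations w then j else 0)" for v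
    by (simp add: finite_rotations)
  show ?thesis
  proof
    assume "?R \<subseteq># M"
    then have "count ?R w \<le> count M w" by (rule mset_subset_eq_count)
    moreover have "w \<in> rotations w" unfolding rotations_def by (rule range_eqI[of _ _ 0]) simp
    ultimately show "j \<le> count M w" by (simp only: count_R if_True)
  next
    assume j: "j \<le> count M w"
    show "?R \<subseteq># M"
    proof (rule mset_subset_eqI)
      fix v show "count ?R v \<le> count M v"
        unfolding count_R using j count_rotate_necklace_msets[OF M] by (auto simp: rotations_def)
    qed
  qed
qed

lemma finite_necklace_msets:
  assumes "finite A"
  shows "finite (necklace_msets m A n)"
proof (rule finite_subset)
  show "necklace_msets m A n \<subseteq> mset ` {xs. set xs \<subseteq> primitive_words m A \<and> length xs = n}"
  proof
    fix M assume M: "M \<in> necklace_msets m A n"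
    obtain xs where "mset xs = M" using ex_mset by blast
    then show "M \<in> mset ` {xs. set xs \<subseteq> primitive_words m A \<and> length xs = n}"
      using M by (auto simp: necklace_msets_def)
  qed
  show "finite (mset ` {xs. set xs \<subseteq> primitive_words m A \<and> length xs = n})"
    by (intro finite_imageI finite_lists_length_eq finite_primitive_words assms)
qed

lemma finite_gr_pairs: "m > 0 \<Longrightarrow> finite A \<Longrightarrow> finite (gr_pairs m n A)"
  using bij_betw_finite[OF bij_betw_gr_mset] finite_necklace_msets by metis

lemma necklace_sum_0: "necklace_sum m A x 0 = 1"
proof -
  have "necklace_msets m A 0 = {{#}}" by (auto simp: necklace_msets_def)
  then show ?thesis by (simp add: necklace_sum_def head_weight_def)
qed

lemma sum_head_weight_remove_rotations:
  assumes w: "w \<in> primitive_words m A" and m: "m > 0" and j: "j \<le> r"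
  shows "(\<Sum>M | M \<in> necklace_msets m A (m * r) \<and> j \<le> count M w. head_weight x M) =
    prod_list (map x w) ^ j * necklace_sum m A x (r - j)"
proof -
  let ?R = "repeat_mset j (mset_set (rotations w))"
  have card_rotations: "card (rotations w) = m"
    using bij_betw_same_card[OF bij_betw_rotations[OF w m]] by simp
  have R_primitive: "set_mset ?R \<subseteq> primitive_words m A"
  proof (rule order.trans)
    show "set_mset ?R \<subseteq> rotations w" by (induction j) (auto simp: finite_rotations)
  qed (rule rotations_subset_primitive_words[OF w])
  have "(\<Sum>M | M \<in> necklace_msets m A (m * r) \<and> j \<le> count M w. head_weight x M) =
      (\<Sum>M\<in>necklace_msets m A (m * (r - j)). head_weight x (M + ?R))"
  proof (rule sum.reindex_bij_witness[of _ "\<lambda>M. M + ?R" "\<lambda>M. M - ?R"])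
    fix M assume M: "M \<in> {M. M \<in> necklace_msets m A (m * r) \<and> j \<le> count M w}"
    then have R_subset: "?R \<subseteq># M" using repeat_rotations_subseteq_iff by blast
    then show "M - ?R + ?R = M" by simp
    then show "head_weight x (M - ?R + ?R) = head_weight x M" by simp
    have "image_mset rotate1 (M - ?R) = M - ?R"
      using M
      by (simp add: image_mset_Diff[OF R_subset] image_rotate1_repeat_rotations necklace_msets_def)
    moreover have "size (M - ?R) = m * (r - j)"
      using M size_Diff_submset[OF R_subset]
      by (simp add: necklace_msets_def card_rotations right_diff_distrib' mult.commute)
    ultimately show "M - ?R \<in> necklace_msets m A (m * (r - j))"
      using M by (auto simp: necklace_msets_def dest: in_diffD)
  next
    fix M assume M: "M \<in> necklace_msets m A (m * (r - j))"
    show "M + ?R - ?R = M" by simp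
    have "size (M + ?R) = m * r"
      using M j
      by (simp add: necklace_msets_def card_rotations mult.commute[of j] flip: distrib_left)
    then have "M + ?R \<in> necklace_msets m A (m * r)"
      using M R_primitive image_rotate1_repeat_rotations[of j w] by (simp add: necklace_msets_def)
    moreover from this have "j \<le> count (M + ?R) w"
      using repeat_rotations_subseteq_iff[of "M + ?R" m A _ j w] by simp
    ultimately show "M + ?R \<in> {M. M \<in> necklace_msets m A (m * r) \<and> j \<le> count M w}" by simp
  qed
  then show ?thesis
    by (simp add: head_weight_add head_weight_repeat_rotations[OF w m] necklace_sum_def
        sum_distrib_left mult.commute)
qed

lemma count_le_necklace_msets:
  assumes M: "M \<in> necklace_msets m A (m * r)" and w: "w \<in> primitive_words m A" and m: "m > 0"
  shows "count M w \<le> r"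
proof -
  have "repeat_mset (count M w) (mset_set (rotations w)) \<subseteq># M"
    by (simp add: repeat_rotations_subseteq_iff[OF M])
  then have "count M w * card (rotations w) \<le> m * r"
    using M size_mset_mono by (fastforce simp: necklace_msets_def)
  then show ?thesis
    using bij_betw_same_card[OF bij_betw_rotations[OF w m]] m by (simp add: mult.commute)
qed

text \<open>Double counting: a multiset on the left has \<open>m (r + 1)\<close> words, and each of multiplicity \<open>c\<close>
  contributes once for every \<open>j < c\<close>.\<close>

lemma necklace_sum_Suc:
  fixes x :: "'a \<Rightarrow> 'b::comm_semiring_1"
  assumes A: "finite A" and m: "m > 0"
  shows "of_nat (m * Suc r) * necklace_sum m A x (Suc r) =
    (\<Sum>j\<le>r. (\<Sum>w\<in>primitive_words m A. prod_list (map x w) ^ Suc j) * necklace_sum m A x (r - j))"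
proof -
  let ?N = "necklace_msets m A (m * Suc r)" and ?P = "primitive_words m A"
  have size: "of_nat (m * Suc r) * y = (\<Sum>w\<in>?P. \<Sum>j\<le>r. if Suc j \<le> count M w then y else 0)"
    if M: "M \<in> ?N" for M and y :: 'b
  proof -
    have size_eq: "size M = (\<Sum>w\<in>?P. count M w)"
      unfolding size_multiset_overloaded_eq
      using M finite_primitive_words[OF A]
      by (intro sum.mono_neutral_left) (auto simp: necklace_msets_def not_in_iff)
    have "of_nat (m * Suc r) * y = of_nat (size M) * y" using M by (simp add: necklace_msets_def)
    also have "\<dots> = (\<Sum>w\<in>?P. of_nat (count M w) * y)" by (simp add: size_eq sum_distrib_right)
    also have "\<dots> = (\<Sum>w\<in>?P. \<Sum>j\<le>r. if Suc j \<le> count M w then y else 0)"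
    proof (rule sum.cong[OF refl])
      fix w assume "w \<in> ?P"
      then have "{..r} \<inter> {j. Suc j \<le> count M w} = {..<count M w}"
        using count_le_necklace_msets[OF M _ m] by fastforce
      then show "of_nat (count M w) * y = (\<Sum>j\<le>r. if Suc j \<le> count M w then y else 0)"
        by (simp add: sum.If_cases)
    qed
    finally show ?thesis .
  qed
  have "of_nat (m * Suc r) * necklace_sum m A x (Suc r) =
      (\<Sum>M\<in>?N. \<Sum>w\<in>?P. \<Sum>j\<le>r. if Suc j \<le> count M w then head_weight x M else 0)"
    unfolding necklace_sum_def sum_distrib_left by (intro sum.cong refl size)
  also have "\<dots> = (\<Sum>w\<in>?P. \<Sum>j\<le>r. \<Sum>M\<in>?N. if Suc j \<le> count M w then head_weight x M else 0)"
    by (subst sum.swap) (rule sum.cong[OF refl], rule sum.swap)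
  also have "\<dots> = (\<Sum>w\<in>?P. \<Sum>j\<le>r. prod_list (map x w) ^ Suc j * necklace_sum m A x (r - j))"
  proof (intro sum.cong refl)
    fix w j assume "w \<in> ?P" "j \<in> {..r}"
    then show "(\<Sum>M\<in>?N. if Suc j \<le> count M w then head_weight x M else 0) =
        prod_list (map x w) ^ Suc j * necklace_sum m A x (r - j)"
      using sum_head_weight_remove_rotations[of w m A "Suc j" "Suc r" x] m
      by (simp add: sum.inter_filter[symmetric] finite_necklace_msets[OF A])
  qed
  also have "\<dots> = (\<Sum>j\<le>r. (\<Sum>w\<in>?P. prod_list (map x w) ^ Suc j) * necklace_sum m A x (r - j))"
    by (subst sum.swap) (simp add: sum_distrib_right)
  finally show ?thesis .
qed

lemma sum_gr_pairs:
  assumes "m > 0"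
  shows "(\<Sum>(p, f)\<in>gr_pairs m (m * r) A. \<Prod>i=1..m * r. x (f i)) = necklace_sum m A x r"
proof -
  have "(case pf of (p, f) \<Rightarrow> \<Prod>i=1..m * r. x (f i)) = head_weight x (gr_mset m (m * r) pf)" for pf
    by (cases pf) (simp add: head_weight_def gr_mset_def multiset.map_comp o_def
        hd_itinerary[OF assms] prod_unfold_prod_mset)
  then show ?thesis
    unfolding necklace_sum_def sum.reindex_bij_betw[OF bij_betw_gr_mset[OF assms], symmetric]
    by (intro sum.cong refl)
qed

section \<open>Counting compatible words\<close>

definition ascents :: "nat \<Rightarrow> (nat \<Rightarrow> nat) \<Rightarrow> nat set" where
  "ascents n p = {i \<in> {1..<n}. p i < p (Suc i)}"

definition tied_words ::
  "nat set \<Rightarrow> nat \<Rightarrow> (nat \<Rightarrow> nat) \<Rightarrow> 'a::linorder set \<Rightarrow> (nat \<Rightarrow> 'a) set" where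
  "tied_words E n p A = {f \<in> compatible_words n p A. \<forall>i\<in>{1..<n}. i \<in> E \<longrightarrow> f i = f (Suc i)}"

lemma tied_words_PiE: "f \<in> tied_words E n p A \<Longrightarrow> f \<in> {1..n} \<rightarrow>\<^sub>E A"
  unfolding tied_words_def compatible_words_def by blast

lemma tied_words_in: "f \<in> tied_words E n p A \<Longrightarrow> i \<in> {1..n} \<Longrightarrow> f i \<in> A"
  by (rule PiE_mem[OF tied_words_PiE])

lemma finite_tied_words:
  assumes "finite A"
  shows "finite (tied_words E n p A)"
proof (rule finite_subset)
  show "tied_words E n p A \<subseteq> {1..n} \<rightarrow>\<^sub>E A" using tied_words_PiE by blast
  show "finite ({1..n} \<rightarrow>\<^sub>E A)" using assms by (intro finite_PiE) simp_all
qed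

lemma mono_on_tied_words: "f \<in> tied_words E n p A \<Longrightarrow> mono_on {1..n} f"
  unfolding tied_words_def using compatible_words_mono by blast

lemma tied_words_imp_subset_ascents:
  assumes "f \<in> tied_words E n p A"
  shows "{1..<n} \<inter> E \<subseteq> ascents n p"
proof
  fix i assume i: "i \<in> {1..<n} \<inter> E"
  then have "f i < f (Suc i) \<or> p i < p (Suc i)" "f i = f (Suc i)"
    using assms unfolding tied_words_def compatible_words_def by blast+
  then show "i \<in> ascents n p" using i by (simp add: ascents_def)
qed

lemma tied_words_change_letters:
  assumes "f \<in> tied_words E n p A" "\<And>i. i \<in> {1..n} \<Longrightarrow> f i \<in> B"
  shows "f \<in> tied_words E n p B"
proof -
  have "f \<in> {1..n} \<rightarrow>\<^sub>E B" using tied_words_PiE[OF assms(1)] assms(2) by (simp add: PiE_iff)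
  then show ?thesis using assms(1) unfolding tied_words_def compatible_words_def by blast
qed

lemma tied_words_subset: "A \<subseteq> B \<Longrightarrow> tied_words E n p A \<subseteq> tied_words E n p B"
  by (rule subsetI, rule tied_words_change_letters, assumption) (use tied_words_in in blast)

lemma tied_words_Int: "tied_words E n p A \<inter> tied_words E n p B = tied_words E n p (A \<inter> B)"
proof
  show "tied_words E n p A \<inter> tied_words E n p B \<subseteq> tied_words E n p (A \<inter> B)"
    by (rule subsetI, rule tied_words_change_letters[of _ E n p A]) (use tied_words_in in blast)+
qed (simp add: tied_words_subset)

lemma fun_upd_in_tied_words_iff:
  assumes "n \<ge> 1" "f (Suc n) = undefined"
  shows "f(Suc n := v) \<in> tied_words E (Suc n) p A \<longleftrightarrow> f \<in> tied_words E n p A \<and> v \<in> A \<and>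
    (f n < v \<or> f n = v \<and> p n < p (Suc n)) \<and> (n \<in> E \<longrightarrow> f n = v)"
proof -
  let ?f = "f(Suc n := v)"
  have range: "?f \<in> {1..Suc n} \<rightarrow>\<^sub>E A \<longleftrightarrow> f \<in> {1..n} \<rightarrow>\<^sub>E A \<and> v \<in> A"
  proof -
    have "{1..Suc n} = insert (Suc n) {1..n}" by auto
    moreover have "?f(Suc n := undefined) = f" using assms(2) by (simp add: fun_upd_idem)
    ultimately show ?thesis
      using fun_upd_in_PiE[of "Suc n" "{1..n}" ?f "\<lambda>_. A"]
        PiE_mem[of ?f "{1..Suc n}" "\<lambda>_. A" "Suc n"]
        PiE_fun_upd[of v "\<lambda>_. A" "Suc n" f "{1..n}"] by auto
  qed
  have "{1..<Suc n} = insert n {1..<n}" using assms(1) by auto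
  then have steps: "(\<forall>i\<in>{1..<Suc n}. P i (?f i) (?f (Suc i))) \<longleftrightarrow>
      (\<forall>i\<in>{1..<n}. P i (f i) (f (Suc i))) \<and> P n (f n) v" for P
    by auto
  show ?thesis
    unfolding tied_words_def compatible_words_def mem_Collect_eq range
      steps[of "\<lambda>i x y. x < y \<or> x = y \<and> p i < p (Suc i)"] steps[of "\<lambda>i x y. i \<in> E \<longrightarrow> x = y"]
    by (simp only: conj_ac)
qed

lemma bij_betw_tied_words_Suc:
  assumes "n \<ge> 1"
  shows "bij_betw (\<lambda>(v, f). f(Suc n := v))
    {(v, f). v \<in> A \<and> f \<in> tied_words E n p A \<and>
      (f n < v \<or> f n = v \<and> p n < p (Suc n)) \<and> (n \<in> E \<longrightarrow> f n = v)}
    (tied_words E (Suc n) p A)"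
    (is "bij_betw ?g ?S ?T")
proof (rule bij_betw_byWitness[where f' = "\<lambda>f. (f (Suc n), f(Suc n := undefined))"])
  have undefined: "f (Suc n) = undefined" if "f \<in> tied_words E n p A" for f
    using PiE_arb[OF tied_words_PiE[OF that]] by simp
  show "\<forall>x\<in>?S. ((?g x) (Suc n), (?g x)(Suc n := undefined)) = x"
    using undefined by (auto simp: fun_upd_idem)
  show "\<forall>f\<in>?T. ?g (f (Suc n), f(Suc n := undefined)) = f" by simp
  show "?g ` ?S \<subseteq> ?T"
    using undefined by (auto simp: fun_upd_in_tied_words_iff[OF assms] simp del: fun_upd_apply)
  show "(\<lambda>f. (f (Suc n), f(Suc n := undefined))) ` ?T \<subseteq> ?S"
  proof (rule image_subsetI)
    fix f assume "f \<in> ?T"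
    then have "(f(Suc n := undefined))(Suc n := f (Suc n)) \<in> ?T" by simp
    then show "(f (Suc n), f(Suc n := undefined)) \<in> ?S"
      by (subst (asm) fun_upd_in_tied_words_iff[OF assms]) auto
  qed
qed

lemma card_tied_words_Suc_tied:
  assumes "n \<ge> 1" "n \<in> E" "p n < p (Suc n)"
  shows "card (tied_words E (Suc n) p A) = card (tied_words E n p A)"
proof -
  have "f n \<in> A" if "f \<in> tied_words E n p A" for f
    using tied_words_in[OF that] assms(1) by simp
  then have "{(v, f). v \<in> A \<and> f \<in> tied_words E n p A \<and>
      (f n < v \<or> f n = v \<and> p n < p (Suc n)) \<and> (n \<in> E \<longrightarrow> f n = v)} =
    (\<lambda>f. (f n, f)) ` tied_words E n p A"
    using assms(2,3) by auto
  then show ?thesis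
    using bij_betw_same_card[OF bij_betw_tied_words_Suc[OF assms(1), of A E p]]
    by (simp add: card_image inj_on_def)
qed

lemma card_tied_words_Suc_free:
  fixes b c :: nat
  assumes "n \<ge> 1" "n \<notin> E"
  shows "card (tied_words E (Suc n) p {b..<c}) =
    (\<Sum>v=b..<c. card (tied_words E n p {b..<v + (if p n < p (Suc n) then 1 else 0)}))"
proof -
  let ?\<delta> = "if p n < p (Suc n) then 1 else 0 :: nat"
  have last: "f \<in> tied_words E n p {b..<c} \<and> (f n < v \<or> f n = v \<and> p n < p (Suc n)) \<longleftrightarrow>
      f \<in> tied_words E n p {b..<v + ?\<delta>}" if v: "v \<in> {b..<c}" for f v
  proof
    assume f: "f \<in> tied_words E n p {b..<c} \<and> (f n < v \<or> f n = v \<and> p n < p (Suc n))"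
    show "f \<in> tied_words E n p {b..<v + ?\<delta>}"
    proof (rule tied_words_change_letters)
      fix i assume i: "i \<in> {1..n}"
      then have "f i \<le> f n"
        using f assms(1) mono_onD[OF mono_on_tied_words, of f E n p _ i n] by auto
      moreover have "b \<le> f i" using tied_words_in[of f E n p "{b..<c}"] f i by auto
      ultimately show "f i \<in> {b..<v + ?\<delta>}" using f by auto
    qed (use f in blast)
  next
    assume f: "f \<in> tied_words E n p {b..<v + ?\<delta>}"
    then have range: "f i \<in> {b..<v + ?\<delta>}" if "i \<in> {1..n}" for i
      using tied_words_in that by blast
    have "f i \<in> {b..<c}" if "i \<in> {1..n}" for i
      using range[OF that] v by (auto split: if_splits)
    then have "f \<in> tied_words E n p {b..<c}" by (rule tied_words_change_letters[OF f])
    then show "f \<in> tied_words E n p {b..<c} \<and> (f n < v \<or> f n = v \<and> p n < p (Suc n))"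
      using range[of n] assms(1) by (auto split: if_splits)
  qed
  have "{(v, f). v \<in> {b..<c} \<and> f \<in> tied_words E n p {b..<c} \<and>
      (f n < v \<or> f n = v \<and> p n < p (Suc n)) \<and> (n \<in> E \<longrightarrow> f n = v)} =
    (SIGMA v:{b..<c}. tied_words E n p {b..<v + ?\<delta>})"
    by (rule set_eqI, clarify) (use assms(2) last in blast)
  then show ?thesis
    using bij_betw_same_card[OF bij_betw_tied_words_Suc[OF assms(1), of "{b..<c}" E p]]
    by (simp add: finite_tied_words)
qed

lemma sum_choose_shift: "a \<le> q \<Longrightarrow> (\<Sum>u<k. (u + a) choose q) = (k + a) choose Suc q"
  by (induction k) auto

lemma card_tied_words:
  fixes b c :: nat
  assumes "n \<ge> 1" "{1..<n} \<inter> E \<subseteq> ascents n p"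
  shows "card (tied_words E n p {b..<c}) =
    (c - b + card (ascents n p - E)) choose Suc (card ({1..<n} - E))"
  using assms
proof (induction n arbitrary: c rule: nat_induct_at_least)
  case base
  have "tied_words E 1 p {b..<c} = {1} \<rightarrow>\<^sub>E {b..<c}"
    by (auto simp: tied_words_def compatible_words_def)
  then show ?case by (simp add: card_PiE ascents_def)
next
  case (Suc n)
  define a q where "a = card (ascents n p - E)" and "q = card ({1..<n} - E)"
  have "a \<le> q" unfolding a_def q_def by (intro card_mono) (auto simp: ascents_def)
  have IH: "card (tied_words E n p {b..<c}) = (c - b + a) choose Suc q" for c
    unfolding a_def q_def by (rule Suc.IH) (use Suc.prems in \<open>auto simp: ascents_def subset_iff\<close>)
  have intervals: "{1..<Suc n} - E = (if n \<in> E then {1..<n} - E else insert n ({1..<n} - E))"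
    "ascents (Suc n) p - E =
      (if p n < p (Suc n) \<and> n \<notin> E then insert n (ascents n p - E) else ascents n p - E)"
    using Suc.hyps by (auto simp: ascents_def less_Suc_eq)
  have finite: "finite (ascents n p)" by (simp add: ascents_def)
  show ?case
  proof (cases "n \<in> E")
    case True
    then have "p n < p (Suc n)" using Suc.prems Suc.hyps by (auto simp: ascents_def subset_iff)
    then show ?thesis
      unfolding intervals card_tied_words_Suc_tied[OF Suc.hyps True \<open>p n < p (Suc n)\<close>] IH
      using True by (simp add: a_def q_def)
  next
    case False
    define \<delta> :: nat where "\<delta> = (if p n < p (Suc n) then 1 else 0)"
    have "card (tied_words E (Suc n) p {b..<c}) = (\<Sum>v=b..<c. (v + \<delta> - b + a) choose Suc q)"
      by (simp only: card_tied_words_Suc_free[OF Suc.hyps False] IH \<delta>_def)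
    also have "\<dots> = (\<Sum>u<c - b. (u + (\<delta> + a)) choose Suc q)"
      by (rule sum.reindex_bij_witness[of _ "\<lambda>u. u + b" "\<lambda>v. v - b"])
        (auto intro!: arg_cong[of _ _ "\<lambda>x. x choose Suc q"])
    also have "\<dots> = (c - b + (\<delta> + a)) choose Suc (Suc q)"
      by (rule sum_choose_shift) (use \<open>a \<le> q\<close> in \<open>simp add: \<delta>_def\<close>)
    finally show ?thesis
      using False finite unfolding intervals
      by (auto simp: \<delta>_def a_def q_def ascents_def)
  qed
qed

lemma tied_words_ends_eq_Diff:
  fixes b c :: nat
  assumes "n \<ge> 1"
  shows "{f \<in> tied_words E n p {b..c}. f 1 = b \<and> f n = c} =
    tied_words E n p {b..<Suc c} - (tied_words E n p {Suc b..<Suc c} \<union> tied_words E n p {b..<c})"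
proof -
  let ?T = "\<lambda>b c. tied_words E n p {b..<c}"
  have "f \<in> ?T (Suc b) (Suc c) \<union> ?T b c \<longleftrightarrow> \<not> (f 1 = b \<and> f n = c)" if f: "f \<in> ?T b (Suc c)" for f
  proof -
    have between: "f 1 \<le> f i" "f i \<le> f n" if "i \<in> {1..n}" for i
      using mono_onD[OF mono_on_tied_words[OF f]] that assms(1) by auto
    have ends: "b \<le> f 1" "f n \<le> c" "f 1 \<le> c" "b \<le> f n"
      using tied_words_in[OF f, of 1] tied_words_in[OF f, of n] assms(1) by auto
    have "f \<in> ?T (Suc b) (Suc c)" if "f 1 \<noteq> b"
      by (rule tied_words_change_letters[OF f]) (use between ends that in fastforce)
    moreover have "f \<in> ?T b c" if "f n \<noteq> c"
      by (rule tied_words_change_letters[OF f]) (use between ends that in fastforce)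
    moreover have "f 1 \<noteq> b" if "f \<in> ?T (Suc b) (Suc c)"
      using tied_words_in[OF that, of 1] assms(1) by simp
    moreover have "f n \<noteq> c" if "f \<in> ?T b c"
      using tied_words_in[OF that, of n] assms(1) by simp
    ultimately show ?thesis by blast
  qed
  then show ?thesis unfolding atLeastLessThanSuc_atLeastAtMost[symmetric] by blast
qed

lemma card_tied_words_ends:
  fixes b c :: nat
  assumes "n \<ge> 1" "{1..<n} \<inter> E \<subseteq> ascents n p" "\<not> {1..<n} \<subseteq> E" "b < c"
  shows "card {f \<in> tied_words E n p {b..c}. f 1 = b \<and> f n = c} =
    (c - b - 1 + card (ascents n p - E)) choose (card ({1..<n} - E) - 1)"
proof -
  let ?T = "\<lambda>b c. tied_words E n p {b..<c}"
  define a q where "a = card (ascents n p - E)" and "q = card ({1..<n} - E) - 1"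
  have q: "card ({1..<n} - E) = Suc q"
    using assms(3) by (simp add: q_def card_gt_0_iff Diff_eq_empty_iff)
  have card: "card (?T b c) = (c - b + a) choose Suc (Suc q)" for b c
    unfolding a_def q[symmetric] by (rule card_tied_words[OF assms(1,2)])
  define d where "d = c - b - 1 + a"
  have lengths: "Suc c - b + a = Suc (Suc d)" "Suc c - Suc b + a = Suc d" "c - b + a = Suc d"
    "c - Suc b + a = d"
    using assms(4) by (simp_all add: d_def)
  have subset: "?T (Suc b) (Suc c) \<subseteq> ?T b (Suc c)" "?T b c \<subseteq> ?T b (Suc c)"
    by (rule tied_words_subset; auto)+
  have "{Suc b..<Suc c} \<inter> {b..<c} = {Suc b..<c}" by auto
  then have inter: "?T (Suc b) (Suc c) \<inter> ?T b c = ?T (Suc b) c" by (simp only: tied_words_Int)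
  have "card (?T (Suc b) (Suc c) \<union> ?T b c) + (d choose Suc (Suc q)) =
      (Suc d choose Suc (Suc q)) + (Suc d choose Suc (Suc q))"
    using card_Un_Int[of "?T (Suc b) (Suc c)" "?T b c"]
    by (simp only: finite_tied_words finite_atLeastLessThan inter card lengths)
  then have "card {f \<in> tied_words E n p {b..c}. f 1 = b \<and> f n = c} = d choose q"
    unfolding tied_words_ends_eq_Diff[OF assms(1)]
    using card_Diff_subset[of "?T (Suc b) (Suc c) \<union> ?T b c" "?T b (Suc c)"] subset
    by (simp add: finite_tied_words card lengths)
  then show ?thesis by (simp add: d_def a_def q_def)
qed

section \<open>Letters of odd multiplicity\<close>

definition odd_letters :: "nat \<Rightarrow> (nat \<Rightarrow> 'a) \<Rightarrow> 'a set" where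
  "odd_letters n f = {a. odd (card {i \<in> {1..n}. f i = a})}"

lemma odd_letters_0 [simp]: "odd_letters 0 f = {}"
  by (simp add: odd_letters_def)

lemma in_odd_letters_Suc_iff:
  "a \<in> odd_letters (Suc n) f \<longleftrightarrow> (a \<in> odd_letters n f) \<noteq> (f (Suc n) = a)"
proof -
  have "{i \<in> {1..Suc n}. f i = a} =
      (if f (Suc n) = a then insert (Suc n) {i \<in> {1..n}. f i = a} else {i \<in> {1..n}. f i = a})"
    by (auto simp: le_Suc_eq)
  then show ?thesis by (simp add: odd_letters_def)
qed

lemma in_odd_letters_Cons_iff:
  "a \<in> odd_letters (Suc n) f \<longleftrightarrow> (a \<in> odd_letters n (\<lambda>i. f (Suc i))) \<noteq> (f 1 = a)"
proof (induction n)
  case (Suc n)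
  then show ?case
    using in_odd_letters_Suc_iff[of a "Suc n" f] in_odd_letters_Suc_iff[of a n "\<lambda>i. f (Suc i)"]
    by auto
qed (simp add: in_odd_letters_Suc_iff)

lemma odd_letters_subset_image: "odd_letters n f \<subseteq> f ` {1..n}"
proof -
  have "a \<notin> odd_letters n f" if "a \<notin> f ` {1..n}" for a
  proof -
    have "{i \<in> {1..n}. f i = a} = {}" using that by auto
    then show ?thesis unfolding odd_letters_def mem_Collect_eq by (simp only: card.empty) simp
  qed
  then show ?thesis by blast
qed

lemma odd_letters_eq_empty_iff:
  fixes f :: "nat \<Rightarrow> 'a::linorder"
  assumes "even n" "mono_on {1..n} f"
  shows "odd_letters n f = {} \<longleftrightarrow> (\<forall>i\<in>{1..<n}. odd i \<longrightarrow> f i = f (Suc i))"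
proof -
  have "odd_letters (2 * k) f = {} \<longleftrightarrow> (\<forall>i\<in>{1..<2 * k}. odd i \<longrightarrow> f i = f (Suc i))"
    if "mono_on {1..2 * k} f" for k
    using that
  proof (induction k)
    case (Suc k)
    let ?n = "2 * k"
    have IH: "odd_letters ?n f = {} \<longleftrightarrow> (\<forall>i\<in>{1..<?n}. odd i \<longrightarrow> f i = f (Suc i))"
      by (rule Suc.IH) (rule mono_on_subset[OF Suc.prems], simp)
    have last: "f (Suc ?n) = f (Suc (Suc ?n))" if empty: "odd_letters (Suc (Suc ?n)) f = {}"
    proof (rule ccontr)
      assume neq: "f (Suc ?n) \<noteq> f (Suc (Suc ?n))"
      have "f i \<le> f (Suc ?n)" "f (Suc ?n) \<le> f (Suc (Suc ?n))" if "i \<in> {1..Suc ?n}" for i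
        using mono_onD[OF Suc.prems] that by auto
      then have "f (Suc (Suc ?n)) \<notin> odd_letters (Suc ?n) f"
        using neq odd_letters_subset_image[of "Suc ?n" f] by fastforce
      then show False using empty in_odd_letters_Suc_iff[of "f (Suc (Suc ?n))" "Suc ?n" f] by simp
    qed
    have "odd_letters (Suc (Suc ?n)) f = odd_letters ?n f" if "f (Suc ?n) = f (Suc (Suc ?n))"
      using that by (intro set_eqI) (auto simp: in_odd_letters_Suc_iff)
    then have "odd_letters (Suc (Suc ?n)) f = {} \<longleftrightarrow>
        odd_letters ?n f = {} \<and> f (Suc ?n) = f (Suc (Suc ?n))"
      using last by auto
    also have "\<dots> \<longleftrightarrow> (\<forall>i\<in>{1..<Suc (Suc ?n)}. odd i \<longrightarrow> f i = f (Suc i))"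
      unfolding IH by (auto simp: less_Suc_eq)
    finally show ?case by simp
  qed simp
  then show ?thesis using assms by (auto elim!: evenE)
qed

lemma mono_on_enclosed_word:
  fixes f :: "nat \<Rightarrow> 'a::linorder"
  assumes mono: "mono_on {1..n} f" and f: "\<And>i. i \<in> {1..n} \<Longrightarrow> f i \<in> {b..c}" and "b \<le> c"
  shows "mono_on {1..n + 2} (\<lambda>i. if i = 1 then b else if i = n + 2 then c else f (i - 1))"
    (is "mono_on _ ?g")
proof (rule mono_onI)
  fix i j assume ij: "i \<in> {1..n + 2}" "j \<in> {1..n + 2}" "i \<le> j"
  have inner: "k - 1 \<in> {1..n}" if "k \<in> {1..n + 2}" "k \<noteq> 1" "k \<noteq> n + 2" for k
    using that by auto
  consider "i = 1" "j = 1" | "j = n + 2" | "i = 1" "j \<noteq> 1" "j \<noteq> n + 2"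
    | "i \<noteq> 1" "j \<noteq> 1" "j \<noteq> n + 2"
    using ij by auto
  then show "?g i \<le> ?g j"
  proof cases
    case 2
    then show ?thesis using f[OF inner[OF ij(1)]] \<open>b \<le> c\<close> by auto
  next
    case 3
    then show ?thesis using f[OF inner[OF ij(2)]] by auto
  next
    case 4
    then have "i \<noteq> n + 2" using ij by auto
    then show ?thesis
      using mono_onD[OF mono inner[OF ij(1)] inner[OF ij(2)]] 4 ij(3) by simp
  qed simp
qed

text \<open>Adding a first letter \<open>b\<close> and a last letter \<open>c\<close> reduces this to the previous case.\<close>

lemma odd_letters_eq_ends_iff:
  fixes f :: "nat \<Rightarrow> 'a::linorder"
  assumes n: "even n" "n > 0" and mono: "mono_on {1..n} f"
    and f: "\<And>i. i \<in> {1..n} \<Longrightarrow> f i \<in> {b..c}" and "b < c"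
  shows "odd_letters n f = {b, c} \<longleftrightarrow>
    f 1 = b \<and> f n = c \<and> (\<forall>i\<in>{1..<n}. even i \<longrightarrow> f i = f (Suc i))"
proof -
  define g where "g i = (if i = 1 then b else if i = n + 2 then c else f (i - 1))" for i
  have "odd_letters n (\<lambda>i. g (Suc i)) = odd_letters n f"
    unfolding odd_letters_def g_def by (intro Collect_cong arg_cong[of _ _ "\<lambda>S. odd (card S)"]) auto
  then have "a \<in> odd_letters (n + 2) g \<longleftrightarrow> (a \<in> odd_letters n f) \<noteq> ((a = b) \<noteq> (a = c))" for a
    using in_odd_letters_Suc_iff[of a "Suc n" g] in_odd_letters_Cons_iff[of a n g]
    by (auto simp: g_def)
  then have "odd_letters n f = {b, c} \<longleftrightarrow> odd_letters (n + 2) g = {}"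
    using \<open>b < c\<close> by (auto simp: set_eq_iff)
  also have "\<dots> \<longleftrightarrow> (\<forall>i\<in>{1..<n + 2}. odd i \<longrightarrow> g i = g (Suc i))"
  proof (rule odd_letters_eq_empty_iff)
    show "mono_on {1..n + 2} g"
      unfolding g_def using mono_on_enclosed_word[OF mono f] \<open>b < c\<close> by simp
  qed (use n in simp)
  also have "{1..<n + 2} = insert 1 (insert (n + 1) (Suc ` {1..<n}))"
    using n(2) by (auto simp: image_iff)
  also have "(\<forall>i\<in>\<dots>. odd i \<longrightarrow> g i = g (Suc i)) \<longleftrightarrow>
      f 1 = b \<and> f n = c \<and> (\<forall>i\<in>{1..<n}. even i \<longrightarrow> f i = f (Suc i))"
    unfolding ball_simps using n by (auto simp: g_def)
  finally show ?thesis .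
qed

section \<open>Gessel-Reutenauer pairs with prescribed odd letters\<close>

definition perms_ascending_on :: "nat set \<Rightarrow> nat \<Rightarrow> nat \<Rightarrow> (nat \<Rightarrow> nat) set" where
  "perms_ascending_on E m n = {p \<in> uniform_perms m n. {1..<n} \<inter> E \<subseteq> ascents n p}"

lemma finite_perms_ascending_on: "finite (perms_ascending_on E m n)"
  unfolding perms_ascending_on_def using finite_uniform_perms[of m n] by simp

lemma card_gr_pairs_tied:
  assumes "finite A"
    and tied: "\<And>p f. f \<in> compatible_words n p A \<Longrightarrow> P f \<longleftrightarrow> Q f \<and> f \<in> tied_words E n p A"
  shows "card {(p, f) \<in> gr_pairs m n A. P f} =
    (\<Sum>p\<in>perms_ascending_on E m n. card {f \<in> tied_words E n p A. Q f})"
proof -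
  have "f \<in> compatible_words n p A" if "f \<in> tied_words E n p A" for p f
    using that by (simp add: tied_words_def)
  then have "{(p, f) \<in> gr_pairs m n A. P f} =
      (SIGMA p:perms_ascending_on E m n. {f \<in> tied_words E n p A. Q f})"
    unfolding gr_pairs_def perms_ascending_on_def
    using tied tied_words_imp_subset_ascents[of _ E n _ A] by blast
  then show ?thesis
    using finite_tied_words[OF assms(1)] finite_perms_ascending_on by simp
qed

lemma card_evens_below:
  assumes "even n" "n \<ge> 2"
  shows "Suc (card ({1..<n} - Collect odd)) = n div 2"
proof -
  have "{1..<n} - Collect odd = (\<lambda>i. 2 * i) ` {1..<n div 2}"
    using assms(1) by (auto elim!: evenE)
  then show ?thesis using assms(2) by (simp add: card_image inj_on_def)
qed

lemma card_odds_below: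
  assumes "even n"
  shows "card ({1..<n} - Collect even) = n div 2"
proof -
  obtain k where k: "n = 2 * k" using assms by (elim evenE)
  have "{1..<n} - Collect even = (\<lambda>i. 2 * i + 1) ` {..<n div 2}"
  proof
    show "{1..<n} - Collect even \<subseteq> (\<lambda>i. 2 * i + 1) ` {..<n div 2}"
    proof
      fix i assume "i \<in> {1..<n} - Collect even"
      then have "i = 2 * (i div 2) + 1" "i div 2 \<in> {..<n div 2}" using k by auto
      then show "i \<in> (\<lambda>i. 2 * i + 1) ` {..<n div 2}" by (rule image_eqI)
    qed
  qed (use k in auto)
  then show ?thesis by (simp add: card_image inj_on_def)
qed

lemma card_gr_pairs_no_odd_letters:
  assumes "even n" "n \<ge> 2"
  shows "card {(p, f) \<in> gr_pairs m n {1..l}. odd_letters n f = {}} =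
    (\<Sum>p\<in>perms_ascending_on (Collect odd) m n.
      (l + card (ascents n p - Collect odd)) choose (n div 2))"
proof -
  have "odd_letters n f = {} \<longleftrightarrow> True \<and> f \<in> tied_words (Collect odd) n p {1..l}"
    if "f \<in> compatible_words n p {1..l}" for p and f :: "nat \<Rightarrow> nat"
    using that odd_letters_eq_empty_iff[OF assms(1) compatible_words_mono[OF that]]
    by (simp add: tied_words_def)
  then have "card {(p, f) \<in> gr_pairs m n {1..l}. odd_letters n f = {}} =
      (\<Sum>p\<in>perms_ascending_on (Collect odd) m n.
        card {f \<in> tied_words (Collect odd) n p {1..l}. True})"
    by (intro card_gr_pairs_tied) simp_all
  also have "\<dots> = (\<Sum>p\<in>perms_ascending_on (Collect odd) m n.
      (l + card (ascents n p - Collect odd)) choose (n div 2))"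
  proof (rule sum.cong[OF refl])
    fix p assume "p \<in> perms_ascending_on (Collect odd) m n"
    then have p: "{1..<n} \<inter> Collect odd \<subseteq> ascents n p" by (simp add: perms_ascending_on_def)
    show "card {f \<in> tied_words (Collect odd) n p {1..l}. True} =
        (l + card (ascents n p - Collect odd)) choose (n div 2)"
      using card_tied_words[of n "Collect odd" p 1 "Suc l"] p assms(2)
        card_evens_below[OF assms(1,2)]
      by (simp add: atLeastLessThanSuc_atLeastAtMost)
  qed
  finally show ?thesis .
qed

lemma card_gr_pairs_odd_ends:
  assumes "even n" "n \<ge> 2" "l \<ge> 2"
  shows "card {(p, f) \<in> gr_pairs m n {1..l}. odd_letters n f = {1, l}} =
    (\<Sum>p\<in>perms_ascending_on (Collect even) m n.
      (l - 2 + card (ascents n p - Collect even)) choose (n div 2 - 1))"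
proof -
  have "odd_letters n f = {1, l} \<longleftrightarrow> (f 1 = 1 \<and> f n = l) \<and> f \<in> tied_words (Collect even) n p {1..l}"
    if f: "f \<in> compatible_words n p {1..l}" for p and f :: "nat \<Rightarrow> nat"
  proof -
    have "f i \<in> {1..l}" if "i \<in> {1..n}" for i
      using f that unfolding compatible_words_def by blast
    then have "odd_letters n f = {1, l} \<longleftrightarrow>
        f 1 = 1 \<and> f n = l \<and> (\<forall>i\<in>{1..<n}. even i \<longrightarrow> f i = f (Suc i))"
      using assms compatible_words_mono[OF f] by (intro odd_letters_eq_ends_iff) auto
    then show ?thesis using f by (simp add: tied_words_def)
  qed
  then have "card {(p, f) \<in> gr_pairs m n {1..l}. odd_letters n f = {1, l}} =
      (\<Sum>p\<in>perms_ascending_on (Collect even) m n.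
        card {f \<in> tied_words (Collect even) n p {1..l}. f 1 = 1 \<and> f n = l})"
    by (intro card_gr_pairs_tied) simp_all
  also have "\<dots> = (\<Sum>p\<in>perms_ascending_on (Collect even) m n.
      (l - 2 + card (ascents n p - Collect even)) choose (n div 2 - 1))"
  proof (rule sum.cong[OF refl])
    fix p assume "p \<in> perms_ascending_on (Collect even) m n"
    then have p: "{1..<n} \<inter> Collect even \<subseteq> ascents n p" by (simp add: perms_ascending_on_def)
    have "1 \<in> {1..<n} - Collect even" using assms(2) by simp
    then have "\<not> {1..<n} \<subseteq> Collect even" by blast
    then show "card {f \<in> tied_words (Collect even) n p {1..l}. f 1 = 1 \<and> f n = l} =
        (l - 2 + card (ascents n p - Collect even)) choose (n div 2 - 1)"
      using card_tied_words_ends[of n "Collect even" p 1 l] p assms(2,3)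
        card_odds_below[OF assms(1)]
      by (simp add: numeral_2_eq_2)
  qed
  finally show ?thesis .
qed

section \<open>Averaging over signs\<close>

definition fps_cosh :: "real fps" where
  "fps_cosh = fps_const (1/2) * (fps_exp 1 + fps_exp (-1))"

definition fps_sinh :: "real fps" where
  "fps_sinh = fps_const (1/2) * (fps_exp 1 - fps_exp (-1))"

text \<open>The expectation of \<open>p(s\<^sup>2)\<close> for a random variable \<open>s\<close> with moment generating function \<open>G\<close>.\<close>

definition square_moment :: "real fps \<Rightarrow> real poly \<Rightarrow> real" where
  "square_moment G p = (\<Sum>i\<le>degree p. coeff p i * (fact (2 * i) * G $ (2 * i)))"

lemma fps_cosh_nth: "fps_cosh $ n = (if even n then 1 / fact n else 0)"
  by (simp add: fps_cosh_def minus_one_power_iff)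

lemma fps_sinh_squared: "fps_sinh\<^sup>2 = fps_cosh\<^sup>2 - 1"
proof -
  have "fps_const (1/2 :: real) * 2 = fps_const (1/2) * fps_const 2"
    by (simp only: fps_numeral_fps_const)
  then have half: "fps_const (1/2 :: real) * 2 = 1" by (simp flip: fps_const_mult)
  have "fps_exp 1 * fps_exp (- 1 :: real) = 1"
    by (subst fps_exp_add_mult[symmetric]) simp
  moreover have "fps_cosh\<^sup>2 - fps_sinh\<^sup>2 =
      (fps_const (1/2) * 2)\<^sup>2 * (fps_exp 1 * fps_exp (-1))"
    unfolding fps_cosh_def fps_sinh_def by (simp add: power2_eq_square algebra_simps)
  ultimately have "fps_cosh\<^sup>2 - fps_sinh\<^sup>2 = 1" unfolding half by simp
  then show ?thesis by (simp add: algebra_simps)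
qed

lemma square_moment_eq_sum:
  assumes "degree p \<le> N"
  shows "square_moment G p = (\<Sum>i\<le>N. coeff p i * (fact (2 * i) * G $ (2 * i)))"
  unfolding square_moment_def
  by (rule sum.mono_neutral_left) (use assms in \<open>auto simp: coeff_eq_0\<close>)

lemma square_moment_diff: "square_moment (G - H) p = square_moment G p - square_moment H p"
  by (simp add: square_moment_def algebra_simps sum_subtractf)

lemma square_moment_cosh: "square_moment fps_cosh p = poly p 1"
  by (simp add: square_moment_def fps_cosh_nth poly_altdef)

lemma fps_exp_sum: "fps_exp (\<Sum>a\<in>A. x a) = (\<Prod>a\<in>A. fps_exp (x a :: real))"
  by (induction A rule: infinite_finite_induct) (simp_all add: fps_exp_add_mult)

lemma sum_signs_fps_exp:
  assumes A: "finite A" and T: "T \<subseteq> A"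
  shows "(\<Sum>x\<in>A \<rightarrow>\<^sub>E {1, -1}. fps_const (\<Prod>a\<in>T. x a) * fps_exp (\<Sum>a\<in>A. x a)) =
    fps_const (2 ^ card A) * (fps_sinh ^ card T * fps_cosh ^ (card A - card T))"
proof -
  let ?g = "\<lambda>a y. (if a \<in> T then fps_const y else 1) * fps_exp (y::real)"
  have "(\<Sum>x\<in>A \<rightarrow>\<^sub>E {1, -1}. fps_const (\<Prod>a\<in>T. x a) * fps_exp (\<Sum>a\<in>A. x a)) =
      (\<Sum>x\<in>A \<rightarrow>\<^sub>E {1, -1}. \<Prod>a\<in>A. ?g a (x a))"
  proof (rule sum.cong[OF refl])
    fix x :: "'a \<Rightarrow> real"
    have "fps_const (\<Prod>a\<in>T. x a) = (\<Prod>a\<in>T. fps_const (x a))"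
      by (induction T rule: infinite_finite_induct) (simp_all flip: fps_const_mult)
    also have "\<dots> = (\<Prod>a\<in>A. if a \<in> T then fps_const (x a) else 1)"
      using A T by (simp add: prod.If_cases Int_absorb1)
    finally show "fps_const (\<Prod>a\<in>T. x a) * fps_exp (\<Sum>a\<in>A. x a) = (\<Prod>a\<in>A. ?g a (x a))"
      by (simp add: fps_exp_sum prod.distrib)
  qed
  also have "\<dots> = (\<Prod>a\<in>A. \<Sum>y\<in>{1, -1}. ?g a y)"
    by (rule prod_sum_PiE[symmetric]) (use A in auto)
  also have "\<dots> = (\<Prod>a\<in>A. fps_const 2 * (if a \<in> T then fps_sinh else fps_cosh))"
    by (rule prod.cong[OF refl])
      (simp add: fps_sinh_def fps_cosh_def mult.assoc[symmetric] flip: fps_const_neg)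
  also have "\<dots> = fps_const (2 ^ card A) * (fps_sinh ^ card (A \<inter> T) * fps_cosh ^ card (A \<inter> - T))"
    using A by (simp add: prod.distrib prod.If_cases)
  also have "A \<inter> T = T" using T by auto
  also have "A \<inter> - T = A - T" by auto
  finally show ?thesis using A T by (simp add: card_Diff_subset finite_subset)
qed

lemma sum_signs_poly:
  assumes "finite A" "T \<subseteq> A"
  shows "(\<Sum>x\<in>A \<rightarrow>\<^sub>E {1, -1}. (\<Prod>a\<in>T. x a) * poly p ((\<Sum>a\<in>A. x a)\<^sup>2)) =
    2 ^ card A * square_moment (fps_sinh ^ card T * fps_cosh ^ (card A - card T)) p"
proof -
  let ?X = "A \<rightarrow>\<^sub>E {1, -1 :: real}" and ?G = "fps_sinh ^ card T * fps_cosh ^ (card A - card T)"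
  have power: "(\<Sum>x\<in>?X. (\<Prod>a\<in>T. x a) * (\<Sum>a\<in>A. x a) ^ n) = 2 ^ card A * (fact n * ?G $ n)" for n
  proof -
    have "(\<Sum>x\<in>?X. (\<Prod>a\<in>T. x a) * (\<Sum>a\<in>A. x a) ^ n) =
        fact n * (\<Sum>x\<in>?X. fps_const (\<Prod>a\<in>T. x a) * fps_exp (\<Sum>a\<in>A. x a)) $ n"
      by (simp add: fps_sum_nth sum_distrib_left)
    then show ?thesis unfolding sum_signs_fps_exp[OF assms] by simp
  qed
  have "(\<Sum>x\<in>?X. (\<Prod>a\<in>T. x a) * poly p ((\<Sum>a\<in>A. x a)\<^sup>2)) =
      (\<Sum>i\<le>degree p. coeff p i * (\<Sum>x\<in>?X. (\<Prod>a\<in>T. x a) * (\<Sum>a\<in>A. x a) ^ (2 * i)))"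
    unfolding poly_altdef sum_distrib_left power_mult[symmetric]
    by (subst sum.swap) (simp add: mult.left_commute)
  then show ?thesis
    unfolding power square_moment_def by (simp add: sum_distrib_left mult.left_commute)
qed

lemma sum_signs_word:
  assumes A: "finite A" and T: "T \<subseteq> A" and f: "f ` {1..n} \<subseteq> A"
  shows "(\<Sum>x\<in>A \<rightarrow>\<^sub>E {1, -1}. (\<Prod>a\<in>T. x a) * (\<Prod>i=1..n. x (f i))) =
    (if odd_letters n f = T then 2 ^ card A else 0 :: real)"
proof -
  define e where "e a = card {i \<in> {1..n}. f i = a} + (if a \<in> T then 1 else 0)" for a
  have "(\<Sum>x\<in>A \<rightarrow>\<^sub>E {1, -1}. (\<Prod>a\<in>T. x a) * (\<Prod>i=1..n. x (f i))) =
      (\<Sum>x\<in>A \<rightarrow>\<^sub>E {1, -1}. \<Prod>a\<in>A. x a ^ e a :: real)"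
  proof (rule sum.cong[OF refl])
    fix x :: "'a \<Rightarrow> real"
    have "(\<Prod>a\<in>T. x a) = (\<Prod>a\<in>A. x a ^ (if a \<in> T then 1 else 0))"
      by (rule prod.mono_neutral_cong_left) (use A T in auto)
    moreover have "(\<Prod>i=1..n. x (f i)) = (\<Prod>a\<in>A. x a ^ card {i \<in> {1..n}. f i = a})"
      by (subst prod.group[OF finite_atLeastAtMost A f, symmetric]) simp
    ultimately show "(\<Prod>a\<in>T. x a) * (\<Prod>i=1..n. x (f i)) = (\<Prod>a\<in>A. x a ^ e a)"
      by (simp add: e_def power_add prod.distrib mult.commute)
  qed
  also have "\<dots> = (\<Prod>a\<in>A. \<Sum>y\<in>{1, -1}. y ^ e a)"
    by (rule prod_sum_PiE[symmetric]) (use A in auto)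
  also have "\<dots> = (\<Prod>a\<in>A. if even (e a) then 2 else 0)"
    by (rule prod.cong) (auto simp: minus_one_power_iff)
  also have "\<dots> = (if \<forall>a\<in>A. even (e a) then 2 ^ card A else 0)"
    using A by auto
  also have "(\<forall>a\<in>A. even (e a)) \<longleftrightarrow> odd_letters n f \<inter> A = T \<inter> A"
    by (auto simp: e_def odd_letters_def split: if_splits)
  also have "\<dots> \<longleftrightarrow> odd_letters n f = T"
    using T order.trans[OF odd_letters_subset_image f] by blast
  finally show ?thesis .
qed

section \<open>The weight of the necklace multisets as a polynomial\<close>

text \<open>\<open>L\<close> is the number of letters, the indeterminate is the square of the letter sum.\<close>

definition cycle_poly :: "nat \<Rightarrow> real \<Rightarrow> nat \<Rightarrow> real poly" where
  "cycle_poly m L j = (\<Sum>d | d dvd m. smult (of_int (moebius d))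
     (if even (j * d) then [:L ^ (m div d):] else monom 1 (m div d div 2)))"

fun necklace_poly :: "nat \<Rightarrow> real \<Rightarrow> nat \<Rightarrow> real poly" where
  "necklace_poly m L 0 = 1"
| "necklace_poly m L (Suc r) = smult (1 / (real m * real (Suc r)))
     (\<Sum>j\<le>r. cycle_poly m L (Suc j) * necklace_poly m L (r - j))"

lemma poly_cycle_poly:
  fixes x :: "'a \<Rightarrow> real"
  assumes A: "finite A" and x: "\<And>a. a \<in> A \<Longrightarrow> x a \<in> {1, -1}" and m: "even m" "m > 0"
  shows "poly (cycle_poly m (real (card A)) j) ((\<Sum>a\<in>A. x a)\<^sup>2) =
    (\<Sum>w\<in>primitive_words m A. prod_list (map x w) ^ j)"
  unfolding sum_primitive_words[OF A m(2)] cycle_poly_def poly_sum poly_smult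
proof (rule sum.cong[OF refl])
  fix d assume "d \<in> {d. d dvd m}"
  then have d: "d dvd m" by simp
  have "poly (if even (j * d) then [:real (card A) ^ (m div d):] else monom 1 (m div d div 2))
      ((\<Sum>a\<in>A. x a)\<^sup>2) = (\<Sum>a\<in>A. x a ^ (j * d)) ^ (m div d)"
  proof (cases "even (j * d)")
    case True
    then have "x a ^ (j * d) = 1" if "a \<in> A" for a
      using x[OF that] by (auto simp: minus_one_power_iff)
    then show ?thesis using True by simp
  next
    case False
    then have "x a ^ (j * d) = x a" if "a \<in> A" for a
      using x[OF that] by (auto simp: minus_one_power_iff)
    moreover have "even (m div d)"
      using d m(1) False by (metis dvd_mult_div_cancel even_mult_iff)
    ultimately show ?thesis using False by (simp add: poly_monom flip: power_mult)
  qed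
  then show "of_int (moebius d) * poly (if even (j * d) then [:real (card A) ^ (m div d):]
      else monom 1 (m div d div 2)) ((\<Sum>a\<in>A. x a)\<^sup>2) =
    of_int (moebius d) * (\<Sum>a\<in>A. x a ^ (j * d)) ^ (m div d)" by simp
qed

lemma poly_necklace_poly:
  fixes x :: "'a \<Rightarrow> real"
  assumes A: "finite A" and x: "\<And>a. a \<in> A \<Longrightarrow> x a \<in> {1, -1}" and m: "even m" "m > 0"
  shows "poly (necklace_poly m (real (card A)) r) ((\<Sum>a\<in>A. x a)\<^sup>2) = necklace_sum m A x r"
proof (induction r rule: less_induct)
  case (less r)
  show ?case
  proof (cases r)
    case (Suc q)
    have "poly (necklace_poly m (real (card A)) r) ((\<Sum>a\<in>A. x a)\<^sup>2) =
        1 / (real m * real (Suc q)) * (\<Sum>j\<le>q. (\<Sum>w\<in>primitive_words m A. prod_list (map x w) ^ Suc j) *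
          necklace_sum m A x (q - j))"
      using less Suc by (simp add: poly_sum poly_cycle_poly[OF A x m])
    also have "\<dots> = 1 / (real m * real (Suc q)) * (real (m * Suc q) * necklace_sum m A x (Suc q))"
      by (simp only: necklace_sum_Suc[OF A m(2)])
    also have "\<dots> = necklace_sum m A x (Suc q)"
      using m by (simp del: of_nat_Suc mult_Suc_right)
    finally show ?thesis by (simp only: Suc)
  qed (simp add: necklace_sum_0)
qed

lemma card_gr_pairs_odd_letters:
  fixes A :: "'a::linorder set"
  assumes A: "finite A" and T: "T \<subseteq> A" and m: "even m" "m > 0"
  shows "real (card {(p, f) \<in> gr_pairs m (m * r) A. odd_letters (m * r) f = T}) =
    square_moment (fps_sinh ^ card T * fps_cosh ^ (card A - card T))
      (necklace_poly m (real (card A)) r)"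
proof -
  let ?X = "A \<rightarrow>\<^sub>E {1, -1 :: real}" and ?G = "gr_pairs m (m * r) A"
  let ?C = "{(p, f) \<in> ?G. odd_letters (m * r) f = T}"
  have "2 ^ card A * real (card ?C) =
      (\<Sum>pf\<in>?G. if odd_letters (m * r) (snd pf) = T then 2 ^ card A else 0)"
    using sum.inter_filter[OF finite_gr_pairs[OF m(2) A], of "\<lambda>_. 2 ^ card A :: real"]
    by (simp add: case_prod_unfold mult.commute)
  also have "\<dots> = (\<Sum>pf\<in>?G. \<Sum>x\<in>?X. (\<Prod>a\<in>T. x a) * (\<Prod>i=1..m * r. x (snd pf i)))"
  proof (rule sum.cong[OF refl])
    fix pf assume "pf \<in> ?G"
    then have "snd pf ` {1..m * r} \<subseteq> A"
      unfolding gr_pairs_def compatible_words_def by (auto simp: PiE_iff)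
    then show "(if odd_letters (m * r) (snd pf) = T then 2 ^ card A else 0) =
        (\<Sum>x\<in>?X. (\<Prod>a\<in>T. x a) * (\<Prod>i=1..m * r. x (snd pf i)))"
      by (rule sum_signs_word[OF A T, symmetric])
  qed
  also have "\<dots> = (\<Sum>x\<in>?X. (\<Prod>a\<in>T. x a) * necklace_sum m A x r)"
    unfolding sum_gr_pairs[OF m(2), symmetric]
    by (subst sum.swap) (simp add: sum_distrib_left case_prod_unfold)
  also have "\<dots> = (\<Sum>x\<in>?X. (\<Prod>a\<in>T. x a) * poly (necklace_poly m (real (card A)) r) ((\<Sum>a\<in>A. x a)\<^sup>2))"
  proof (rule sum.cong[OF refl])
    fix x assume "x \<in> ?X"
    then have "x a \<in> {1, -1}" if "a \<in> A" for a using that by (rule PiE_mem)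
    then show "(\<Prod>a\<in>T. x a) * necklace_sum m A x r =
        (\<Prod>a\<in>T. x a) * poly (necklace_poly m (real (card A)) r) ((\<Sum>a\<in>A. x a)\<^sup>2)"
      using poly_necklace_poly[OF A _ m] by simp
  qed
  finally show ?thesis unfolding sum_signs_poly[OF A T] by simp
qed

section \<open>Polynomial continuation in the number of letters\<close>

definition cosh_power :: "real \<Rightarrow> real fps" where
  "cosh_power c = fps_binomial c oo (fps_cosh - 1)"

lemma cosh_power_of_nat: "cosh_power (real n) = fps_cosh ^ n"
  unfolding cosh_power_def fps_binomial_of_nat
  by (subst fps_compose_power[symmetric]) (simp_all add: fps_compose_add_distrib fps_cosh_nth)

lemma cosh_power_minus_1: "cosh_power (-1) = inverse fps_cosh"
  unfolding cosh_power_def fps_binomial_minus_one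
  by (subst fps_inverse_compose) (simp_all add: fps_compose_add_distrib fps_cosh_nth)

lemma real_polynomial_function_eqI:
  fixes f g :: "real \<Rightarrow> real"
  assumes "real_polynomial_function f" "real_polynomial_function g" "infinite {x. f x = g x}"
  shows "f = g"
proof -
  obtain a n where a: "\<And>x. f x - g x = (\<Sum>i\<le>n. a i * x ^ i)"
    using real_polynomial_function_imp_sum[OF real_polynomial_function_diff[OF assms(1,2)]] by metis
  have "infinite {x. (\<Sum>i\<le>n. a i * x ^ i) = 0}" using assms(3) by (simp flip: a)
  then have "\<forall>i\<le>n. a i = 0" using polyfun_finite_roots[where c = a and n = n] by blast
  then have "f x - g x = 0" for x by (simp add: a)
  then show ?thesis by (simp add: fun_eq_iff)
qed

lemma real_polynomial_function_ident: "real_polynomial_function (\<lambda>x :: real. x)"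
  by (rule real_polynomial_function.intros(1)) (rule bounded_linear_ident)

lemma real_polynomial_function_gbinomial:
  "real_polynomial_function f \<Longrightarrow> real_polynomial_function (\<lambda>x. f x gchoose k)"
  unfolding gbinomial_prod_rev
  by (intro real_polynomial_function_divide real_polynomial_function_prod
      real_polynomial_function_diff real_polynomial_function.intros(2)) simp_all

lemmas real_polynomial_function_intros =
  real_polynomial_function.intros(2-4) real_polynomial_function_ident real_polynomial_function_diff
  real_polynomial_function_power real_polynomial_function_sum real_polynomial_function_gbinomial

lemma real_polynomial_function_cosh_power:
  "real_polynomial_function (\<lambda>x. (G * cosh_power (x - c)) $ n)"
  unfolding cosh_power_def fps_mult_nth fps_compose_nth fps_binomial_nth
  by (intro real_polynomial_function_intros) simp_all

lemma real_polynomial_function_coeff_cycle_poly: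
  "real_polynomial_function (\<lambda>L. coeff (cycle_poly m L j) i)"
proof (cases "m = 0")
  case False
  have "real_polynomial_function
      (\<lambda>L. coeff (if even (j * d) then [:L ^ (m div d):] else monom 1 (m div d div 2)) i)" for d
    by (cases "even (j * d)"; cases i) (auto intro: real_polynomial_function_intros)
  then show ?thesis
    using False unfolding cycle_poly_def coeff_sum coeff_smult
    by (intro real_polynomial_function_intros) simp_all
qed (simp add: cycle_poly_def real_polynomial_function.intros(2))

lemma real_polynomial_function_coeff_necklace_poly:
  "real_polynomial_function (\<lambda>L. coeff (necklace_poly m L r) i)"
proof (induction r arbitrary: i rule: less_induct)
  case (less r)
  show ?case
  proof (cases r)
    case (Suc q)
    show ?thesis
      unfolding Suc necklace_poly.simps coeff_smult coeff_sum coeff_mult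
      using less Suc
      by (intro real_polynomial_function_intros real_polynomial_function_coeff_cycle_poly) simp_all
  qed (simp add: real_polynomial_function.intros(2))
qed

lemma degree_cycle_poly:
  assumes "m > 0"
  shows "degree (cycle_poly m L j) \<le> m"
  unfolding cycle_poly_def
proof (rule degree_sum_le)
  fix d
  have "degree (monom (1::real) (m div d div 2)) \<le> m"
    using degree_monom_le[of "1::real" "m div d div 2"] div_le_dividend[of m d]
      div_le_dividend[of "m div d" 2] by linarith
  then show "degree (smult (of_int (moebius d))
      (if even (j * d) then [:L ^ (m div d):] else monom 1 (m div d div 2))) \<le> m"
    by (intro order.trans[OF degree_smult_le]) simp
qed (use assms in simp)

lemma degree_necklace_poly:
  assumes "m > 0"
  shows "degree (necklace_poly m L r) \<le> m * r"
proof (induction r rule: less_induct)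
  case (less r)
  show ?case
  proof (cases r)
    case (Suc q)
    have "degree (cycle_poly m L (Suc j) * necklace_poly m L (q - j)) \<le> m * r" if "j \<le> q" for j
    proof -
      have "degree (necklace_poly m L (q - j)) \<le> m * (q - j)" using less Suc by simp
      moreover have "m + m * (q - j) \<le> m * r"
        using Suc that by (simp flip: mult_Suc_right)
      ultimately show ?thesis
        using degree_mult_le[of "cycle_poly m L (Suc j)" "necklace_poly m L (q - j)"]
          degree_cycle_poly[OF assms, of L "Suc j"] by linarith
    qed
    then show ?thesis
      unfolding Suc necklace_poly.simps
      by (intro order.trans[OF degree_smult_le] degree_sum_le) (auto simp: Suc)
  qed simp
qed

lemma real_polynomial_function_square_moment_necklace_poly:
  assumes "m > 0"
  shows "real_polynomial_function
    (\<lambda>L. square_moment (G * cosh_power (L - c)) (necklace_poly m L r))"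
  unfolding square_moment_eq_sum[OF degree_necklace_poly[OF assms]]
  by (intro real_polynomial_function_intros real_polynomial_function_coeff_necklace_poly
      real_polynomial_function_cosh_power) simp

lemma gbinomial_pred_nat:
  assumes "a \<le> k"
  shows "(real a - 1) gchoose k = (if a = 0 then (-1) ^ k else 0)"
proof (cases a)
  case 0
  then show ?thesis using gbinomial_minus[of "1::real" k] by (simp flip: binomial_gbinomial)
next
  case (Suc b)
  then have "(real a - 1) gchoose k = real (b choose k)" by (simp add: binomial_gbinomial)
  then show ?thesis using Suc assms by simp
qed

text \<open>At \<open>L = t - 1\<close> the binomial coefficients select the \<open>p\<close> with \<open>a p = 0\<close>.\<close>

lemma square_moment_necklace_poly_eq_card:
  assumes "m > 0" "finite P" and a: "\<And>p. p \<in> P \<Longrightarrow> a p \<le> k"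
    and words: "\<And>l. l \<ge> 2 \<Longrightarrow> l \<ge> t \<Longrightarrow>
      square_moment (fps_sinh ^ t * fps_cosh ^ (l - t)) (necklace_poly m (real l) r) =
      real (\<Sum>p\<in>P. (l - t + a p) choose k)"
  shows "square_moment (fps_sinh ^ t * inverse fps_cosh) (necklace_poly m (real t - 1) r) =
    (-1) ^ k * real (card {p \<in> P. a p = 0})"
proof -
  let ?f = "\<lambda>L. square_moment (fps_sinh ^ t * cosh_power (L - real t)) (necklace_poly m L r)"
  let ?g = "\<lambda>L. \<Sum>p\<in>P. (L - real t + real (a p)) gchoose k"
  have "?f = ?g"
  proof (rule real_polynomial_function_eqI)
    show "real_polynomial_function ?f"
      by (rule real_polynomial_function_square_moment_necklace_poly[OF assms(1)])
    show "real_polynomial_function ?g"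
      using assms(2) by (intro real_polynomial_function_intros)
    have "real l \<in> {L. ?f L = ?g L}" if l: "l \<ge> 2" "l \<ge> t" for l
    proof -
      have "real l - real t = real (l - t)" using l by simp
      then show ?thesis
        by (simp only: mem_Collect_eq cosh_power_of_nat words[OF l] of_nat_sum
            binomial_gbinomial of_nat_add)
    qed
    then have "real ` {max 2 t..} \<subseteq> {L. ?f L = ?g L}" by auto
    moreover have "infinite (real ` {max 2 t..})" by (simp add: finite_image_iff infinite_Ici)
    ultimately show "infinite {L. ?f L = ?g L}" using finite_subset by blast
  qed
  then have "?f (real t - 1) = ?g (real t - 1)" by (rule fun_cong)
  also have "\<dots> = (\<Sum>p\<in>P. if a p = 0 then (-1) ^ k else 0)"
    using gbinomial_pred_nat[OF a] by (intro sum.cong refl) (simp add: add.commute)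
  finally show ?thesis
    using assms(2) by (simp add: cosh_power_minus_1 sum.inter_filter[symmetric])
qed

section \<open>Counting alternating permutations\<close>

lemma ascents_eq_iff:
  assumes "p permutes {1..n}"
  shows "reverse_alternating n p \<longleftrightarrow> ascents n p = {1..<n} \<inter> Collect odd"
    and "alternating n p \<longleftrightarrow> ascents n p = {1..<n} \<inter> Collect even"
proof -
  have "p i \<noteq> p (Suc i)" for i using permutes_inj[OF assms] by (auto simp: inj_eq)
  then have descent: "p (Suc i) < p i \<longleftrightarrow> \<not> p i < p (Suc i)" for i
    using linorder_less_linear[of "p i" "p (Suc i)"] by auto
  show "reverse_alternating n p \<longleftrightarrow> ascents n p = {1..<n} \<inter> Collect odd"
    unfolding reverse_alternating_def ascents_def set_eq_iff by (simp add: descent) blast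
  show "alternating n p \<longleftrightarrow> ascents n p = {1..<n} \<inter> Collect even"
    unfolding alternating_def ascents_def set_eq_iff by (simp add: descent) blast
qed

lemma uniform_perms_eq_cycle_type:
  assumes "m > 0"
  shows "uniform_perms m (m * r) =
    {p. p permutes {1..m * r} \<and> cycle_type p {1..m * r} = replicate_mset r m}"
  unfolding uniform_perms_def
  using cycle_type_eq_replicate_iff[of _ "{1..m * r}" m r] assms by (intro Collect_cong) auto

lemma b_rev_eq_card_ascents:
  assumes "m > 0"
  shows "b_rev m r =
    card {p \<in> uniform_perms m (m * r). ascents (m * r) p = {1..<m * r} \<inter> Collect odd}"
  unfolding b_rev_def uniform_perms_eq_cycle_type[OF assms] using ascents_eq_iff(1)
  by (intro arg_cong[of _ _ card]) auto

lemma b_alt_eq_card_ascents: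
  assumes "m > 0"
  shows "b_alt m r =
    card {p \<in> uniform_perms m (m * r). ascents (m * r) p = {1..<m * r} \<inter> Collect even}"
  unfolding b_alt_def uniform_perms_eq_cycle_type[OF assms] using ascents_eq_iff(2)
  by (intro arg_cong[of _ _ card]) auto

lemma permutes_eq_id_if_all_ascents:
  assumes "p permutes {1..n}" "ascents n p = {1..<n}" "i \<in> {1..n}"
  shows "p i = i"
proof -
  have "strict_mono_on {1..n} p"
  proof (rule strict_mono_onI)
    fix i j assume "i \<in> {1..n}" "j \<in> {1..n}" and "i < j"
    then have "{i..<j} \<subseteq> {1..<n}" by auto
    moreover have "p k < p (Suc k)" if "k \<in> {1..<n}" for k
      using that assms(2) unfolding ascents_def by blast
    ultimately show "p i < p j" using lift_Suc_mono_less_ivl[of "{1..<n}" p] \<open>i < j\<close> by blast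
  qed
  then show ?thesis
    using strict_mono_on_eq_if_same_image[of "{1..n}" p id i] permutes_image[OF assms(1)] assms(3)
    by (simp add: strict_mono_on_def)
qed

lemma ascents_uniform_perms:
  assumes "p \<in> uniform_perms m n" "m \<ge> 2" "n \<ge> 1"
  shows "ascents n p \<noteq> {1..<n}"
proof
  assume "ascents n p = {1..<n}"
  then have "p 1 = 1"
    using permutes_eq_id_if_all_ascents[of p n 1] assms by (auto simp: uniform_perms_def)
  then have "least_power p 1 \<le> 1" by (intro least_power_le) simp_all
  moreover have "least_power p 1 = m" using assms by (simp add: uniform_perms_def)
  ultimately show False using assms(2) by simp
qed

lemma perms_ascending_on_no_other_ascents:
  "{p \<in> perms_ascending_on E m n. card (ascents n p - E) = 0} =
    {p \<in> uniform_perms m n. ascents n p = {1..<n} \<inter> E}"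
proof -
  have "finite (ascents n p)" "ascents n p \<subseteq> {1..<n}" for p by (auto simp: ascents_def)
  then show ?thesis by (auto simp: perms_ascending_on_def card_eq_0_iff)
qed

lemma card_ascents_diff_even_less:
  assumes p: "p \<in> perms_ascending_on (Collect even) m n" and "m \<ge> 2" "even n" "n \<ge> 1"
  shows "card (ascents n p - Collect even) < n div 2"
proof -
  have "ascents n p \<noteq> {1..<n}"
    using p assms(2,4) by (intro ascents_uniform_perms) (simp_all add: perms_ascending_on_def)
  then have "ascents n p - Collect even \<subset> {1..<n} - Collect even"
    using p by (auto simp: perms_ascending_on_def ascents_def)
  then have "card (ascents n p - Collect even) < card ({1..<n} - Collect even)"
    by (intro psubset_card_mono) simp_all
  then show ?thesis using card_odds_below[OF assms(3)] by simp
qed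

lemma b_rev_eq_square_moment:
  assumes m: "even m" "m > 0" and r: "r > 0"
  shows "(-1) ^ (m * r div 2) * real (b_rev m r) =
    square_moment (inverse fps_cosh) (necklace_poly m (-1) r)"
proof -
  define n where "n = m * r"
  have n: "even n" "n \<ge> 2" using m r by (auto simp: n_def elim!: evenE)
  let ?P = "perms_ascending_on (Collect odd) m n"
  have "square_moment (fps_sinh ^ 0 * inverse fps_cosh) (necklace_poly m (real 0 - 1) r) =
      (-1) ^ (n div 2) * real (card {p \<in> ?P. card (ascents n p - Collect odd) = 0})"
  proof (rule square_moment_necklace_poly_eq_card[OF m(2)])
    show "finite ?P" by (rule finite_perms_ascending_on)
    show "card (ascents n p - Collect odd) \<le> n div 2" for p
    proof -
      have "card (ascents n p - Collect odd) \<le> card ({1..<n} - Collect odd)"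
        by (intro card_mono) (auto simp: ascents_def)
      then show ?thesis using card_evens_below[OF n] by simp
    qed
    show "square_moment (fps_sinh ^ 0 * fps_cosh ^ (l - 0)) (necklace_poly m (real l) r) =
        real (\<Sum>p\<in>?P. (l - 0 + card (ascents n p - Collect odd)) choose (n div 2))" for l
      using card_gr_pairs_odd_letters[of "{1..l}" "{}" m r] m
        card_gr_pairs_no_odd_letters[OF n, of m l]
      by (simp add: n_def)
  qed
  then show ?thesis
    unfolding perms_ascending_on_no_other_ascents
    by (simp add: b_rev_eq_card_ascents[OF m(2)] n_def)
qed

lemma poly_cycle_poly_1_1:
  assumes "m > 1"
  shows "poly (cycle_poly m 1 j) 1 = 0"
proof -
  have "poly (cycle_poly m 1 j) 1 = (\<Sum>d | d dvd m. of_int (moebius d))"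
    unfolding cycle_poly_def poly_sum by (intro sum.cong) (auto simp: poly_monom)
  then show ?thesis using sum_moebius_divisors[of m, where 'b = real] assms by simp
qed

lemma poly_necklace_poly_1_1: "m > 1 \<Longrightarrow> r > 0 \<Longrightarrow> poly (necklace_poly m 1 r) 1 = 0"
  by (cases r) (simp_all add: poly_sum poly_cycle_poly_1_1)

lemma fps_sinh_squared_inverse_cosh: "fps_sinh\<^sup>2 * inverse fps_cosh = fps_cosh - inverse fps_cosh"
proof -
  have "fps_cosh * inverse fps_cosh = 1"
    by (rule inverse_mult_eq_1') (simp add: fps_cosh_nth)
  moreover have "fps_sinh\<^sup>2 * inverse fps_cosh =
      fps_cosh * (fps_cosh * inverse fps_cosh) - inverse fps_cosh"
    unfolding fps_sinh_squared by (simp add: algebra_simps power2_eq_square)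
  ultimately show ?thesis by simp
qed

lemma b_alt_eq_square_moment:
  assumes m: "even m" "m > 0" and r: "r > 0"
  shows "(-1) ^ (m * r div 2) * real (b_alt m r) =
    square_moment (inverse fps_cosh) (necklace_poly m 1 r)"
proof -
  define n where "n = m * r"
  have n: "even n" "n \<ge> 2" using m r by (auto simp: n_def elim!: evenE)
  define k where "k = n div 2 - 1"
  have k: "n div 2 = Suc k" using n by (auto simp: k_def elim!: evenE)
  have "m \<ge> 2" using m by (auto elim!: evenE)
  let ?P = "perms_ascending_on (Collect even) m n"
  have "square_moment (fps_sinh ^ 2 * inverse fps_cosh) (necklace_poly m (real 2 - 1) r) =
      (-1) ^ k * real (card {p \<in> ?P. card (ascents n p - Collect even) = 0})"
  proof (rule square_moment_necklace_poly_eq_card[OF m(2)])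
    show "finite ?P" by (rule finite_perms_ascending_on)
    show "card (ascents n p - Collect even) \<le> k" if "p \<in> ?P" for p
      using card_ascents_diff_even_less[OF that] \<open>m \<ge> 2\<close> n k by simp
    show "square_moment (fps_sinh ^ 2 * fps_cosh ^ (l - 2)) (necklace_poly m (real l) r) =
        real (\<Sum>p\<in>?P. (l - 2 + card (ascents n p - Collect even)) choose k)" if "l \<ge> 2" for l
    proof -
      have ends: "card {1, l} = 2" using that by simp
      have "real (card {(p, f) \<in> gr_pairs m n {1..l}. odd_letters n f = {1, l}}) =
          square_moment (fps_sinh ^ card {1, l} * fps_cosh ^ (card {1..l} - card {1, l}))
            (necklace_poly m (real (card {1..l})) r)"
        unfolding n_def by (rule card_gr_pairs_odd_letters) (use m that in auto)
      then show ?thesis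
        unfolding card_gr_pairs_odd_ends[OF n that] ends by (simp add: k_def)
    qed
  qed
  then have "square_moment (fps_cosh - inverse fps_cosh) (necklace_poly m 1 r) =
      (-1) ^ k * real (b_alt m r)"
    unfolding perms_ascending_on_no_other_ascents fps_sinh_squared_inverse_cosh
    by (simp add: b_alt_eq_card_ascents[OF m(2)] n_def)
  then show ?thesis
    using \<open>m \<ge> 2\<close> r k
    by (simp add: square_moment_diff square_moment_cosh poly_necklace_poly_1_1 n_def)
qed

section \<open>Secant numbers\<close>

lemma inverse_cosh_nth_even:
  "inverse fps_cosh $ (2 * i) = (-1) ^ i * inverse (fps_cos 1 :: real fps) $ (2 * i)"
proof -
  define C :: "real fps" where "C = Abs_fps (\<lambda>k. 1 / fact (2 * k))"
  have "fps_cosh = C oo fps_X\<^sup>2"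
    by (rule fps_ext) (auto simp: fps_cosh_nth C_def fps_nth_compose_X_power elim!: evenE)
  then have cosh: "inverse fps_cosh = inverse C oo fps_X\<^sup>2"
    by (simp add: fps_inverse_compose C_def)
  have "fps_cos 1 = C oo - fps_X oo fps_X\<^sup>2"
    by (rule fps_ext)
      (auto simp: fps_cos_def C_def fps_nth_compose_X_power fps_compose_uminus' elim!: evenE)
  moreover have "inverse (C oo - fps_X) = inverse C oo - fps_X"
    by (rule fps_inverse_compose[symmetric]) (simp_all add: C_def)
  ultimately have "inverse (fps_cos 1) = inverse C oo - fps_X oo fps_X\<^sup>2"
    by (simp add: fps_inverse_compose C_def)
  then show ?thesis unfolding cosh by (simp add: fps_nth_compose_X_power fps_compose_uminus')
qed

lemma fps_tan_nth_even: "even n \<Longrightarrow> fps_tan (1::real) $ n = 0"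
proof -
  assume "even n"
  have "fps_sin (1::real) oo - fps_X = - fps_sin 1" "fps_cos (1::real) oo - fps_X = fps_cos 1"
    by (auto simp: fps_eq_iff fps_compose_uminus' fps_sin_def fps_cos_def)
  then have "fps_tan (1::real) oo - fps_X = - fps_tan 1"
    unfolding fps_tan_def by (subst fps_divide_compose) (simp_all add: fps_divide_unit)
  then have "(fps_tan (1::real) oo - fps_X) $ n = - (fps_tan 1 $ n)" by simp
  then show ?thesis using \<open>even n\<close> by (simp add: fps_compose_uminus')
qed

lemma inverse_cosh_moment:
  "fact (2 * i) * inverse fps_cosh $ (2 * i) = (-1) ^ i * euler_number (2 * i)"
  by (simp add: inverse_cosh_nth_even euler_number_def fps_tan_nth_even)

section \<open>Umbral evaluation\<close>

lemma smult_sum_right: "smult c (\<Sum>i\<in>I. f i) = (\<Sum>i\<in>I. smult c (f i))"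
  by (induction I rule: infinite_finite_induct) (simp_all add: smult_add_right)

lemma umbral_eval_eq_sum:
  assumes "degree p \<le> N"
  shows "umbral_eval p = (\<Sum>k\<le>N. coeff p k * euler_number k)"
  unfolding umbral_eval_def
  by (rule sum.mono_neutral_left) (use assms in \<open>auto simp: coeff_eq_0\<close>)

lemma umbral_eval_add: "umbral_eval (p + q) = umbral_eval p + umbral_eval q"
proof -
  have "umbral_eval f = (\<Sum>k\<le>max (degree p) (degree q). coeff f k * euler_number k)"
    if "f \<in> {p, q, p + q}" for f
    by (rule umbral_eval_eq_sum) (use that degree_add_le_max in auto)
  then show ?thesis by (simp add: algebra_simps sum.distrib)
qed

lemma umbral_eval_smult: "umbral_eval (smult c p) = c * umbral_eval p"
  using umbral_eval_eq_sum[OF degree_smult_le[of c p]]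
  by (simp add: umbral_eval_def sum_distrib_left mult.assoc)

lemma umbral_eval_0 [simp]: "umbral_eval 0 = 0"
  by (simp add: umbral_eval_def)

lemma umbral_eval_sum: "umbral_eval (\<Sum>i\<in>I. f i) = (\<Sum>i\<in>I. umbral_eval (f i))"
  by (induction I rule: infinite_finite_induct) (simp_all add: umbral_eval_add)

lemma umbral_eval_monom: "umbral_eval (monom c k) = c * euler_number k"
  using umbral_eval_eq_sum[OF degree_monom_le[of c k]]
  by (simp add: if_distrib if_distribR cong: if_cong)

text \<open>Turns the moments of \<open>1 / cosh\<close> into secant numbers.\<close>

definition subst_neg_sq :: "real poly \<Rightarrow> real poly" where
  "subst_neg_sq p = pcompose p (monom (-1) 2)"

lemma subst_neg_sq_monom: "subst_neg_sq (monom c k) = monom (c * (-1) ^ k) (2 * k)"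
  by (induction k)
    (simp_all add: subst_neg_sq_def monom_0 monom_Suc[of c] pcompose_pCons mult_monom)

lemma subst_neg_sq_const [simp]: "subst_neg_sq [:c:] = [:c:]"
  by (simp add: subst_neg_sq_def)

lemma subst_neg_sq_diff: "subst_neg_sq (p - q) = subst_neg_sq p - subst_neg_sq q"
  by (simp add: subst_neg_sq_def pcompose_diff)

lemma subst_neg_sq_smult: "subst_neg_sq (smult c p) = smult c (subst_neg_sq p)"
  by (simp add: subst_neg_sq_def pcompose_smult)

lemma subst_neg_sq_sum: "subst_neg_sq (\<Sum>i\<in>I. f i) = (\<Sum>i\<in>I. subst_neg_sq (f i))"
  by (simp add: subst_neg_sq_def pcompose_sum)

lemma subst_neg_sq_mult: "subst_neg_sq (p * q) = subst_neg_sq p * subst_neg_sq q"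
  by (simp add: subst_neg_sq_def pcompose_mult)

lemma umbral_eval_subst_neg_sq:
  "umbral_eval (subst_neg_sq p) = square_moment (inverse fps_cosh) p"
proof -
  have "umbral_eval (subst_neg_sq p) =
      umbral_eval (subst_neg_sq (\<Sum>i\<le>degree p. monom (coeff p i) i))"
    by (simp only: poly_as_sum_of_monoms)
  also have "\<dots> = (\<Sum>i\<le>degree p. coeff p i * ((-1) ^ i * euler_number (2 * i)))"
    by (simp add: subst_neg_sq_sum subst_neg_sq_monom umbral_eval_sum umbral_eval_monom mult.assoc)
  finally show ?thesis by (simp add: square_moment_def inverse_cosh_moment)
qed

definition signed_cycle_poly :: "nat \<Rightarrow> real \<Rightarrow> nat \<Rightarrow> real poly" where
  "signed_cycle_poly m L j = smult ((-1) ^ (m div 2 * j)) (subst_neg_sq (cycle_poly m L j))"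

definition signed_necklace_fps :: "nat \<Rightarrow> real \<Rightarrow> real poly fps" where
  "signed_necklace_fps m L =
     Abs_fps (\<lambda>r. smult ((-1) ^ (m div 2 * r)) (subst_neg_sq (necklace_poly m L r)))"

definition signed_cycle_fps :: "nat \<Rightarrow> real \<Rightarrow> real poly fps" where
  "signed_cycle_fps m L = Abs_fps (\<lambda>j. smult (1 / real m) (signed_cycle_poly m L (Suc j)))"

lemma umbral_signed_necklace_fps_nth:
  assumes "even m"
  shows "umbral (signed_necklace_fps m L) $ r =
    (-1) ^ (m * r div 2) * square_moment (inverse fps_cosh) (necklace_poly m L r)"
proof -
  have "m div 2 * r = m * r div 2" using assms by (auto elim!: evenE)
  then show ?thesis
    by (simp add: umbral_def signed_necklace_fps_def umbral_eval_smult umbral_eval_subst_neg_sq)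
qed

lemma umbral_signed_necklace_fps_0: "umbral (signed_necklace_fps m L) $ 0 = 1"
proof -
  have "inverse fps_cosh $ 0 = 1" by (simp add: fps_cosh_nth)
  then show ?thesis
    by (simp add: umbral_def signed_necklace_fps_def umbral_eval_subst_neg_sq square_moment_def)
qed

lemma F_rev_eq_umbral:
  assumes "even m" "m > 0"
  shows "F_rev m = umbral (signed_necklace_fps m (-1))"
proof (rule fps_ext)
  fix r
  show "F_rev m $ r = umbral (signed_necklace_fps m (-1)) $ r"
  proof (cases "r = 0")
    case True
    then show ?thesis
      by (simp add: F_rev_def b_rev_def reverse_alternating_def cycle_type_def
          umbral_signed_necklace_fps_0)
  next
    case False
    then show ?thesis
      using b_rev_eq_square_moment[OF assms, of r, symmetric]
      by (simp add: F_rev_def umbral_signed_necklace_fps_nth[OF assms(1)])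
  qed
qed

lemma F_alt_eq_umbral:
  assumes "even m" "m > 0"
  shows "F_alt m = umbral (signed_necklace_fps m 1)"
proof (rule fps_ext)
  fix r
  show "F_alt m $ r = umbral (signed_necklace_fps m 1) $ r"
  proof (cases "r = 0")
    case True
    then show ?thesis
      by (simp add: F_alt_def b_alt_def alternating_def cycle_type_def
          umbral_signed_necklace_fps_0)
  next
    case False
    then show ?thesis
      using b_alt_eq_square_moment[OF assms, of r, symmetric]
      by (simp add: F_alt_def umbral_signed_necklace_fps_nth[OF assms(1)])
  qed
qed

section \<open>Exponential form\<close>

lemma fps_linear_ODE_unique:
  fixes F G D :: "'a::{idom, ring_char_0} fps"
  assumes "fps_deriv F = F * D" "fps_deriv G = G * D" "F $ 0 = G $ 0"
  shows "F = G"
proof (rule fps_ext)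
  fix n show "F $ n = G $ n"
  proof (induction n rule: less_induct)
    case (less n)
    show ?case
    proof (cases n)
      case (Suc k)
      have "(F * D) $ k = (G * D) $ k"
        unfolding fps_mult_nth using less Suc by (intro sum.cong) auto
      then have "fps_deriv F $ k = fps_deriv G $ k" by (simp only: assms)
      then have "of_nat (Suc k) * F $ Suc k = of_nat (Suc k) * G $ Suc k"
        by (simp only: fps_deriv_nth Suc_eq_plus1)
      moreover have "of_nat (Suc k) \<noteq> (0 :: 'a)" by (simp only: of_nat_eq_0_iff)
      ultimately show ?thesis using Suc by simp
    qed (simp add: assms)
  qed
qed

lemma signed_necklace_fps_0 [simp]: "signed_necklace_fps m L $ 0 = 1"
  by (simp add: signed_necklace_fps_def subst_neg_sq_def pcompose_1)

lemma fps_deriv_signed_necklace_fps: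
  "fps_deriv (signed_necklace_fps m L) = signed_necklace_fps m L * signed_cycle_fps m L"
proof (rule fps_ext)
  fix r
  let ?s = "\<lambda>r. (-1 :: real) ^ (m div 2 * r)"
  have sign: "?s (Suc r) = ?s (Suc j) * ?s (r - j)" if "j \<le> r" for j
  proof -
    have "Suc r = Suc j + (r - j)" using that by simp
    then show ?thesis by (metis distrib_left power_add)
  qed
  have factor: "real (Suc r) * (?s (Suc r) * (1 / (real m * real (Suc r)))) = ?s (Suc r) / real m"
    by (simp del: of_nat_Suc)
  have "fps_deriv (signed_necklace_fps m L) $ r =
      smult (?s (Suc r) / real m)
        (subst_neg_sq (\<Sum>j\<le>r. cycle_poly m L (Suc j) * necklace_poly m L (r - j)))"
    unfolding factor[symmetric]
    by (simp add: signed_necklace_fps_def of_nat_poly subst_neg_sq_smult del: of_nat_Suc)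
  also have "\<dots> = (\<Sum>j\<le>r. signed_cycle_fps m L $ j * signed_necklace_fps m L $ (r - j))"
    unfolding subst_neg_sq_sum smult_sum_right
  proof (rule sum.cong[OF refl])
    fix j assume "j \<in> {..r}"
    then have "?s (Suc r) = ?s (Suc j) * ?s (r - j)" by (intro sign) simp
    then show "smult (?s (Suc r) / real m)
        (subst_neg_sq (cycle_poly m L (Suc j) * necklace_poly m L (r - j))) =
      signed_cycle_fps m L $ j * signed_necklace_fps m L $ (r - j)"
      by (simp only:) (simp add: signed_cycle_fps_def signed_necklace_fps_def
          signed_cycle_poly_def subst_neg_sq_mult mult_ac)
  qed
  also have "\<dots> = (signed_necklace_fps m L * signed_cycle_fps m L) $ r"
    by (simp add: mult.commute[of "signed_necklace_fps m L"] fps_mult_nth atMost_atLeast0)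
  finally show "fps_deriv (signed_necklace_fps m L) $ r =
      (signed_necklace_fps m L * signed_cycle_fps m L) $ r" .
qed

lemma fps_deriv_fps_log:
  fixes f :: "real fps"
  assumes "f $ 0 = 1"
  shows "f * fps_deriv (fps_log f) = fps_deriv f"
proof -
  have "fps_deriv (fps_log f) = (inverse (1 + fps_X) oo (f - 1)) * fps_deriv (f - 1)"
    unfolding fps_log_def by (subst fps_compose_deriv) (simp_all add: assms fps_ln_deriv)
  also have "inverse (1 + fps_X) oo (f - 1) = inverse f"
    by (subst fps_inverse_compose) (simp_all add: assms fps_compose_add_distrib)
  finally have "f * fps_deriv (fps_log f) = f * inverse f * fps_deriv f" by (simp add: mult.assoc)
  then show ?thesis using inverse_mult_eq_1'[of f] assms by simp
qed

lemma fps_deriv_log_ratio: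
  "fps_deriv (fps_log ((1 + fps_X) / (1 - fps_X))) = Abs_fps (\<lambda>j. if even j then 2 else 0)"
    (is "_ = ?D")
proof -
  define f :: "real fps" where "f = (1 + fps_X) / (1 - fps_X)"
  let ?L = "fps_deriv (fps_log f)"
  have f: "f * (1 - fps_X) = 1 + fps_X"
    unfolding f_def by (subst fps_divide_unit) (simp_all add: mult.assoc inverse_mult_eq_1)
  have "(f * (1 - fps_X)) $ 0 = 1" unfolding f by simp
  then have "f $ 0 = 1" by simp
  have "fps_deriv (f * (1 - fps_X)) = 1" unfolding f by simp
  then have "fps_deriv f * (1 - fps_X) = 1 + f" by (simp add: algebra_simps)
  then have log_deriv: "f * ?L * (1 - fps_X) = 1 + f"
    by (simp only: fps_deriv_fps_log[OF \<open>f $ 0 = 1\<close>])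
  have "(f * (1 - fps_X)) * ?L * (1 - fps_X) = f * ?L * (1 - fps_X) * (1 - fps_X)"
    by (simp only: mult_ac)
  also have "\<dots> = (1 - fps_X) + f * (1 - fps_X)"
    unfolding log_deriv by (simp only: distrib_right mult_1_left)
  finally have "(1 + fps_X) * ?L * (1 - fps_X) = (1 - fps_X) + (1 + fps_X)" unfolding f .
  then have "?L * (1 - fps_X\<^sup>2) = 2" by (simp add: algebra_simps power2_eq_square)
  also have "2 = ?D * (1 - fps_X\<^sup>2)"
    by (rule fps_ext)
      (auto simp: fps_numeral_nth right_diff_distrib fps_X_power_mult_right_nth)
  finally have "?L * (1 - fps_X\<^sup>2) = ?D * (1 - fps_X\<^sup>2)" .
  moreover have "(1 - fps_X\<^sup>2 :: real fps) $ 0 \<noteq> 0" by simp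
  then have "(1 - fps_X\<^sup>2 :: real fps) \<noteq> 0" by (metis fps_zero_nth)
  ultimately show ?thesis by (simp add: f_def)
qed

lemma fps_deriv_fps_lift: "fps_deriv (fps_lift f) = fps_lift (fps_deriv f)"
  by (rule fps_ext) (simp add: fps_lift_def of_nat_poly)

lemma fps_pow_poly_0 [simp]: "fps_pow_poly f g $ 0 = 1"
  by (simp add: fps_pow_poly_def fps_lift_def)

lemma fps_deriv_fps_pow_poly:
  "fps_deriv (fps_pow_poly f g) =
    fps_pow_poly f g * (fps_const g * fps_lift (fps_deriv (fps_log f)))"
proof -
  let ?u = "fps_const g * fps_lift (fps_log f)"
  have "?u $ 0 = 0" by (simp add: fps_lift_def fps_log_def)
  then have "fps_deriv (fps_pow_poly f g) = (fps_deriv (fps_lift (fps_exp 1)) oo ?u) * fps_deriv ?u"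
    unfolding fps_pow_poly_def by (rule fps_compose_deriv)
  then show ?thesis by (simp add: fps_pow_poly_def fps_deriv_fps_lift)
qed

lemma umbral_signed_necklace_fps_eq_ratio_pow:
  assumes cycle: "\<And>j. signed_cycle_poly m L j = (if odd j then q else 0)"
  shows "umbral (signed_necklace_fps m L) = umbral_ratio_pow (smult (1 / (2 * real m)) q)"
proof -
  let ?g = "smult (1 / (2 * real m)) q"
  have "signed_cycle_fps m L = fps_const ?g * fps_lift (Abs_fps (\<lambda>j. if even j then 2 else 0))"
    by (rule fps_ext) (simp add: signed_cycle_fps_def cycle fps_lift_def)
  then have "fps_deriv (signed_necklace_fps m L) = signed_necklace_fps m L *
      (fps_const ?g * fps_lift (fps_deriv (fps_log ((1 + fps_X) / (1 - fps_X)))))"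
    by (simp only: fps_deriv_signed_necklace_fps fps_deriv_log_ratio)
  then have "signed_necklace_fps m L = fps_pow_poly ((1 + fps_X) / (1 - fps_X)) ?g"
    by (rule fps_linear_ODE_unique[OF _ fps_deriv_fps_pow_poly]) simp
  then show ?thesis by (simp only: umbral_ratio_pow_def)
qed

section \<open>The cycle polynomials at \<open>1\<close> and \<open>-1\<close>\<close>

lemma odd_divisors_eq:
  fixes h :: nat
  assumes "odd h"
  shows "{d. d dvd 2 ^ k * h \<and> \<not> 2 dvd d} = {d. d dvd h}"
proof (intro Collect_cong iffI)
  fix d assume d: "d dvd 2 ^ k * h \<and> \<not> 2 dvd d"
  then have "coprime d (2 ^ k)" by simp
  then show "d dvd h" using d by (metis coprime_dvd_mult_right_iff)
next
  fix d assume "d dvd h"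
  then show "d dvd 2 ^ k * h \<and> \<not> 2 dvd d" using assms by (meson dvd_mult dvd_trans)
qed

lemma cycle_poly_two_power_mult_odd:
  assumes m: "m = 2 ^ Suc k * h" and h: "odd h" and L: "L = 1 \<or> L = -1"
  shows "cycle_poly m L j =
    (\<Sum>d | d dvd h. smult (of_int (moebius d)) (if odd j then monom 1 (2 ^ k * (h div d)) else 1)) -
    [:if h = 1 then L ^ 2 ^ k else 0:]"
proof -
  have "h > 0" using h by (auto intro: Nat.gr0I)
  define g :: "nat \<Rightarrow> real poly" where
    "g d = (if even (j * d) then [:L ^ (m div d):] else monom 1 (m div d div 2))" for d
  have g: "g d = (if odd j then monom 1 (2 ^ k * (h div d)) else 1)" "g (2 * d) = [:L ^ 2 ^ k:]"
    if "d dvd h" for d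
  proof -
    from that obtain e where e: "h = d * e" by auto
    then have odd: "odd d" "odd e" and "d > 0" using h by (auto intro: Nat.gr0I)
    have div: "m div d = 2 * (2 ^ k * e)" "m div (2 * d) = 2 ^ k * e" "h div d = e"
      using \<open>d > 0\<close> by (simp_all add: m e mult.left_commute[of d] mult.commute[of _ d])
    have "L ^ (2 * n) = 1" for n using L by (auto simp: power_mult)
    then show "g d = (if odd j then monom 1 (2 ^ k * (h div d)) else 1)"
      using odd by (simp add: g_def div one_pCons)
    have "L ^ (2 ^ k * e) = L ^ 2 ^ k" using L odd by (auto simp: minus_one_power_iff)
    then show "g (2 * d) = [:L ^ 2 ^ k:]" by (simp add: g_def div)
  qed
  have "cycle_poly m L j = (\<Sum>d | d dvd m. of_int (moebius d) * g d)"
    unfolding cycle_poly_def g_def by (simp add: of_int_poly)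
  also have "\<dots> = (\<Sum>d | d dvd h. of_int (moebius d) * (g d - g (2 * d)))"
    using sum_moebius_prime_split[of m 2 g] \<open>h > 0\<close> odd_divisors_eq[OF h, of "Suc k"]
    by (simp add: m)
  also have "\<dots> = (\<Sum>d | d dvd h. of_int (moebius d) * g d) -
      (\<Sum>d | d dvd h. of_int (moebius d)) * [:L ^ 2 ^ k:]"
    unfolding sum_distrib_right sum_subtractf[symmetric] right_diff_distrib[symmetric]
    by (intro sum.cong refl) (simp add: g(2))
  finally show ?thesis
    unfolding sum_moebius_divisors[OF \<open>h > 0\<close>] by (simp add: g(1) of_int_poly)
qed

lemma smult_subst_neg_sq_monom_two_power:
  assumes "odd i" "odd e"
  shows "smult ((-1) ^ (2 ^ k * i)) (subst_neg_sq (monom 1 (2 ^ k * e))) = monom 1 (2 ^ Suc k * e)"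
  using assms by (simp add: subst_neg_sq_monom smult_monom mult.assoc minus_one_power_iff)

lemma signed_cycle_poly_two_power_mult_odd:
  assumes m: "m = 2 ^ Suc k * h" and h: "odd h" and L: "L = 1 \<or> L = -1"
  shows "signed_cycle_poly m L j =
    (if odd j then \<Sum>d | d dvd h. smult (of_int (moebius d)) (monom 1 (m div d))
     else [:if h = 1 then 1 else 0:]) - [:if h = 1 then (-1) ^ (2 ^ k * j) * L ^ 2 ^ k else 0:]"
proof -
  let ?s = "(-1 :: real) ^ (2 ^ k * j)" and ?\<mu> = "\<lambda>d. of_int (moebius d) :: real"
  let ?g = "\<lambda>d. if odd j then monom 1 (2 ^ k * (h div d)) else 1 :: real poly"
  have sign: "(-1 :: real) ^ (m div 2 * j) = ?s"
    using h by (simp add: m minus_one_power_iff)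
  have "signed_cycle_poly m L j = (\<Sum>d | d dvd h. smult (?\<mu> d) (smult ?s (subst_neg_sq (?g d)))) -
      [:if h = 1 then ?s * L ^ 2 ^ k else 0:]"
    unfolding signed_cycle_poly_def cycle_poly_two_power_mult_odd[OF assms] sign
      subst_neg_sq_diff subst_neg_sq_sum subst_neg_sq_smult smult_diff_right smult_sum_right
    by (simp add: mult.commute[of ?s])
  also have "(\<Sum>d | d dvd h. smult (?\<mu> d) (smult ?s (subst_neg_sq (?g d)))) =
      (if odd j then \<Sum>d | d dvd h. smult (?\<mu> d) (monom 1 (m div d))
       else [:if h = 1 then 1 else 0:])"
  proof (cases "odd j")
    case True
    have "smult ?s (subst_neg_sq (?g d)) = monom 1 (m div d)" if "d dvd h" for d
    proof -
      from that obtain e where e: "h = d * e" by auto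
      then have "odd e" "d > 0" using h by (auto intro: Nat.gr0I)
      then have "h div d = e" "m div d = 2 ^ Suc k * e"
        by (simp_all add: m e mult.left_commute[of d])
      then show ?thesis
        using smult_subst_neg_sq_monom_two_power[OF True \<open>odd e\<close>, of k] True by simp
    qed
    then show ?thesis using True by simp
  next
    case False
    have "h > 0" using h by (auto intro: Nat.gr0I)
    then show ?thesis
      using False sum_moebius_divisors[of h, where 'b = "real poly"]
      by (simp add: subst_neg_sq_def pcompose_1 of_int_poly one_pCons)
  qed
  finally show ?thesis .
qed

section \<open>The generating functions\<close>

lemma F_eq_umbral_ratio_pow:
  assumes "even m" "m > 0"
    and "\<And>L j. L = 1 \<or> L = -1 \<Longrightarrow> signed_cycle_poly m L j = (if odd j then q else 0)"
  shows "F_alt m = F_rev m \<and> F_alt m = umbral_ratio_pow (smult (1 / (2 * real m)) q)"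
  unfolding F_alt_eq_umbral[OF assms(1,2)] F_rev_eq_umbral[OF assms(1,2)]
  using umbral_signed_necklace_fps_eq_ratio_pow[OF assms(3)] by simp

lemma F_two_power_mult_odd:
  assumes "m = 2 ^ k * h" "k \<ge> 1" "odd h" "h \<ge> 3"
  shows "F_alt m = F_rev m \<and> F_alt m = umbral_ratio_pow
    (smult (1 / (2 * real m)) (\<Sum>d | d dvd h. smult (of_int (moebius d)) (monom 1 (m div d))))"
proof (rule F_eq_umbral_ratio_pow)
  fix L :: real and j assume "L = 1 \<or> L = -1"
  moreover have "m = 2 ^ Suc (k - 1) * h" using assms(1,2) by simp
  ultimately show "signed_cycle_poly m L j =
      (if odd j then \<Sum>d | d dvd h. smult (of_int (moebius d)) (monom 1 (m div d)) else 0)"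
    using signed_cycle_poly_two_power_mult_odd[of m "k - 1" h L j] assms(3,4) by simp
qed (use assms in auto)

lemma F_two_power:
  assumes "m = 2 ^ k" "k \<ge> 2"
  shows "F_alt m = F_rev m \<and> F_alt m = umbral_ratio_pow (smult (1 / (2 * real m)) (monom 1 m - 1))"
proof (rule F_eq_umbral_ratio_pow)
  fix L :: real and j assume L: "L = 1 \<or> L = -1"
  have "even (2 ^ (k - 1) :: nat)" using assms(2) by simp
  then have "(-1 :: real) ^ (2 ^ (k - 1) * j) = 1" "L ^ 2 ^ (k - 1) = 1"
    using L by (auto simp: minus_one_power_iff)
  moreover have "m = 2 ^ Suc (k - 1) * 1" using assms by simp
  ultimately show "signed_cycle_poly m L j = (if odd j then monom 1 m - 1 else 0)"
    using signed_cycle_poly_two_power_mult_odd[of m "k - 1" 1 L j] L by (simp add: one_pCons)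
qed (use assms in auto)

lemma signed_cycle_poly_2:
  assumes "L = 1 \<or> L = -1"
  shows "signed_cycle_poly 2 L j = (if odd j then monom 1 2 + [:L:] else [:1 - L:])"
  using signed_cycle_poly_two_power_mult_odd[of 2 0 1 L j] assms by simp

lemma F_alt_2: "F_alt 2 = umbral_ratio_pow (smult (1 / 4) (monom 1 2 + 1))"
  using umbral_signed_necklace_fps_eq_ratio_pow[of 2 1 "monom 1 2 + 1"]
  by (simp add: F_alt_eq_umbral signed_cycle_poly_2 one_pCons)

lemma signed_necklace_fps_2:
  "signed_necklace_fps 2 (-1) * (1 + fps_X) = signed_necklace_fps 2 1"
proof (rule fps_linear_ODE_unique)
  have "signed_cycle_fps 2 (-1) * (1 + fps_X) + 1 = signed_cycle_fps 2 1 * (1 + fps_X)"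
  proof (rule fps_ext)
    fix n
    have "monom 1 2 = [:0, 0, 1 :: real:]" by (simp add: monom_altdef power2_eq_square)
    then show "(signed_cycle_fps 2 (-1) * (1 + fps_X) + 1) $ n =
        (signed_cycle_fps 2 1 * (1 + fps_X)) $ n"
      by (cases n) (simp_all add: signed_cycle_fps_def signed_cycle_poly_2 distrib_left one_pCons)
  qed
  then have "signed_necklace_fps 2 (-1) * (signed_cycle_fps 2 (-1) * (1 + fps_X) + 1) =
      signed_necklace_fps 2 (-1) * (1 + fps_X) * signed_cycle_fps 2 1"
    by (simp only: mult_ac)
  then show "fps_deriv (signed_necklace_fps 2 (-1) * (1 + fps_X)) =
      signed_necklace_fps 2 (-1) * (1 + fps_X) * signed_cycle_fps 2 1"
    by (simp add: fps_deriv_signed_necklace_fps algebra_simps)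
qed (simp_all add: fps_deriv_signed_necklace_fps)

lemma F_rev_2: "F_rev 2 = F_alt 2 / (1 + fps_X)"
proof -
  have "umbral (f * (1 + fps_X)) = umbral f * (1 + fps_X)" for f
    by (rule fps_ext) (simp add: umbral_def distrib_left umbral_eval_add)
  then have "F_alt 2 = F_rev 2 * (1 + fps_X)"
    by (simp add: F_alt_eq_umbral F_rev_eq_umbral flip: signed_necklace_fps_2)
  moreover have "(1 + fps_X :: real fps) $ 0 \<noteq> 0" by simp
  then have "(1 + fps_X :: real fps) \<noteq> 0" by (metis fps_zero_nth)
  ultimately show ?thesis by simp
qed

theorem theorem5p5:
  shows "(\<forall>m k h :: nat. m = 2 ^ k * h \<and> k \<ge> 1 \<and> h \<ge> 3 \<and> odd h \<longrightarrow>
            F_alt m = F_rev m \<and>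
            F_alt m = umbral_ratio_pow
              (smult (1 / (2 * real m))
                (\<Sum>d | d dvd h. smult (of_int (moebius d)) (monom 1 (m div d)))))
       \<and> (\<forall>m k :: nat. m = 2 ^ k \<and> k \<ge> 2 \<longrightarrow>
            F_alt m = F_rev m \<and>
            F_alt m = umbral_ratio_pow (smult (1 / (2 * real m)) (monom 1 m - 1)))
       \<and> F_alt 2 = umbral_ratio_pow (smult (1 / 4) (monom 1 2 + 1))
       \<and> F_rev 2 = F_alt 2 / (1 + fps_X)"
  using F_two_power_mult_odd F_two_power F_alt_2 F_rev_2 by blast

end
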